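(* For every integer $n \geq 585$ there exists a geometric $(n_6)$ configuration. Equivalently, $N_6 \le 585$, where $N_6$ denotes the smallest integer such that a geometric $(n_6)$ configuration exists for every $n \ge N_6$.
   Context: A geometric $(n_k)$ configuration is a collection of $n$ points and $n$ straight lines in the Euclidean plane such that each of the lines passes through exactly $k$ of the points and each of the points lies on exactly $k$ of the lines. For each $k$, $N_k$ denotes the least integer such that for all $n \ge N_k$ there exists at least one geometric $(n_k)$ configuration. *)

theory Defs
  imports "HOL-Analysis.Analysis"
begin

definition straight_line :: "(real^2) set \<Rightarrow> bool" where
  "straight_line l \<longleftrightarrow> affine l \<and> aff_dim l = 1"

definition geometric_configuration ::
    "nat \<Rightarrow> nat \<Rightarrow> (real^2) set \<Rightarrow> (real^2) set set \<Rightarrow> bool" where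
  "geometric_configuration n k P L \<longleftrightarrow>
     finite P \<and> card P = n \<and>
     finite L \<and> card L = n \<and> (\<forall>l\<in>L. straight_line l) \<and>
     (\<forall>l\<in>L. card {p \<in> P. p \<in> l} = k) \<and>
     (\<forall>p\<in>P. card {l \<in> L. p \<in> l} = k)"

definition has_geometric_configuration :: "nat \<Rightarrow> nat \<Rightarrow> bool" where
  "has_geometric_configuration n k \<longleftrightarrow> (\<exists>P L. geometric_configuration n k P L)"

(* LEAST is unspecified if no such m exists, so a bound on N_conf k is only
   informative together with the existence of some such m. *)
definition N_conf :: "nat \<Rightarrow> nat" where
  "N_conf k = (LEAST m. \<forall>n\<ge>m. has_geometric_configuration n k)"

end

(* Let C consist of finitely many points and lines of the plane such that every point is on 5 or 6
   of the lines and every line contains 5 or 6 of the points, and let t > 1. The six images of a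
   point under the maps (x, y) -> (t^j x, y) lie on a horizontal line, and the six images of a line
   meet on the y-axis. So the six images of C, together with these horizontal lines for the points
   of degree 5 and these points of the y-axis for the lines of degree 5, form an (n_6) configuration
   with n = 6 |P| + #(lines of degree 5) = 6 (|P| + |L|) - #incidences, provided that C is in general
   position and t is large. Removing from C a point or a line all of whose neighbours have degree 6
   leaves such a system, and lowers n by 6 - d if d is the degree of the removed element. A chain of
   removals therefore gives a whole interval of values of n. Sixteen such systems, found by a
   computer search among points and lines with small coordinates in Q, Q(sqrt 3) and Q(sqrt 5), yield
   intervals that together with their pairwise sums cover 580..866; disjoint unions do the rest. *)

theory Submission
  imports Defs "HOL-Computational_Algebra.Primes"
begin

subsection \<open>Incidence in slope coordinates\<close>

text \<open>Scaling points by \<open>(x, y) -> (s^i x, y)\<close> turns the line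
  \<open>(m, k)\<close> into \<open>(m / s^i, k)\<close>. Copy \<open>i\<close> of a point therefore
  lies on copy \<open>j\<close> of a line iff \<open>y + k = s^(i-j) x m\<close>. For
  \<open>i = j\<close> this is the original incidence. For \<open>i \<noteq> j\<close> it has to
  fail, and one large \<open>s\<close> achieves this for all pairs, because only finitely many
  ratios \<open>(y + k) / (x m)\<close> occur. The added horizontal lines and axis points raise a
  degree by exactly one. The listed systems violate general position, for all of them contain points
  with \<open>x = 0\<close>. It is produced afterwards by a two-parameter family of affine maps that
  keep every incidence. Slope coordinates know neither points at infinity nor vertical lines. A
  symmetric system that uses the line at infinity can be listed only after a projective change of
  coordinates, so its symmetry is hidden in the numbers.\<close>

text \<open>A pair \<open>(x, y)\<close> stands for a point and a pair \<open>(m, k)\<close> for the line \<open>y = m x - k\<close>. With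
  this sign incidence is symmetric, so that points and lines can be interchanged in all arguments.\<close>

type_synonym pair = "real \<times> real"

definition inc :: "pair \<Rightarrow> pair \<Rightarrow> bool" where
  "inc p l \<longleftrightarrow> snd p + snd l = fst p * fst l"

lemma inc_commute: "inc p l \<longleftrightarrow> inc l p"
  by (simp add: inc_def add.commute mult.commute)

definition deg :: "pair set \<Rightarrow> pair \<Rightarrow> nat" where
  "deg A e = card {p \<in> A. inc p e}"

definition slope_configuration :: "nat \<Rightarrow> nat \<Rightarrow> pair set \<Rightarrow> pair set \<Rightarrow> bool" where
  "slope_configuration n k A B \<longleftrightarrow> finite A \<and> finite B \<and> card A = n \<and> card B = n \<and>
     (\<forall>l\<in>B. deg A l = k) \<and> (\<forall>p\<in>A. deg B p = k)"

definition point_of :: "pair \<Rightarrow> real^2" where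
  "point_of p = vector [fst p, snd p]"

definition line_of :: "pair \<Rightarrow> (real^2) set" where
  "line_of l = {v. v $ 2 + snd l = v $ 1 * fst l}"

lemma point_of_in_line_of [simp]: "point_of p \<in> line_of l \<longleftrightarrow> inc p l"
  by (simp add: point_of_def line_of_def inc_def vector_2)

lemma inj_point_of: "inj point_of"
proof (rule injI)
  fix p q assume "point_of p = point_of q"
  hence "point_of p $ 1 = point_of q $ 1" "point_of p $ 2 = point_of q $ 2" by simp_all
  thus "p = q" by (simp add: point_of_def vector_2 prod_eq_iff)
qed

lemma inj_line_of: "inj line_of"
proof (rule injI)
  fix l l' assume eq: "line_of l = line_of l'"
  have "inc (0, - snd l) l" "inc (1, fst l - snd l) l" by (simp_all add: inc_def)
  hence "inc (0, - snd l) l'" "inc (1, fst l - snd l) l'" using eq point_of_in_line_of by blast+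
  thus "l = l'" by (simp add: inc_def prod_eq_iff)
qed

lemma straight_line_line_of: "straight_line (line_of l)"
proof -
  let ?a = "point_of (0, - snd l)" and ?b = "point_of (1, fst l - snd l)"
  have ne: "?a \<noteq> ?b" using inj_point_of by (auto dest: injD)
  have "line_of l = affine hull {?a, ?b}"
  proof (intro equalityI subsetI)
    fix v assume v: "v \<in> line_of l"
    \<comment> \<open>The base points have abscissae 0 and 1, so the abscissa of \<open>v\<close> is
      itself the affine weight.\<close>
    have "v = (1 - v $ 1) *\<^sub>R ?a + (v $ 1) *\<^sub>R ?b"
      using v by (simp add: line_of_def point_of_def vec_eq_iff forall_2 vector_2 algebra_simps)
    thus "v \<in> affine hull {?a, ?b}" unfolding affine_hull_2 by fastforce
  next
    fix v assume "v \<in> affine hull {?a, ?b}"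
    then obtain u w where uw: "v = u *\<^sub>R ?a + w *\<^sub>R ?b" "u + w = 1"
      unfolding affine_hull_2 by auto
    then have "u = 1 - w" by simp
    thus "v \<in> line_of l"
      unfolding uw(1) \<open>u = 1 - w\<close>
      by (simp add: line_of_def point_of_def vector_2 algebra_simps)
  qed
  thus ?thesis
    unfolding straight_line_def using ne by (simp add: aff_dim_2)
qed

lemma slope_configuration_imp_geometric:
  assumes "slope_configuration n k A B"
  shows "has_geometric_configuration n k"
proof -
  have P: "{p \<in> point_of ` A. p \<in> line_of l} = point_of ` {p \<in> A. inc p l}" for l by auto
  have L: "{l \<in> line_of ` B. point_of p \<in> l} = line_of ` {l \<in> B. inc l p}" for p
    by (auto simp: inc_commute)
  have ip: "inj_on point_of U" and il: "inj_on line_of V" for U V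
    using inj_point_of inj_line_of by (meson inj_on_subset subset_UNIV)+
  have "geometric_configuration n k (point_of ` A) (line_of ` B)"
    using assms
    by (simp add: geometric_configuration_def slope_configuration_def deg_def
        P L card_image ip il straight_line_line_of)
  thus ?thesis unfolding has_geometric_configuration_def by blast
qed

text \<open>The second configuration is translated vertically by \<open>c\<close>. Every unwanted
  coincidence or incidence is a linear equation in \<open>c\<close> with coefficient 1 or -1, so it
  excludes a single value, and finitely many exclusions leave a good \<open>c\<close>.\<close>

lemma slope_configuration_union:
  assumes 1: "slope_configuration n1 k A1 B1" and 2: "slope_configuration n2 k A2 B2"
  shows "\<exists>A B. slope_configuration (n1 + n2) k A B"
proof -
  note f = 1[unfolded slope_configuration_def] 2[unfolded slope_configuration_def]
  \<comment> \<open>The four images collect the values of \<open>c\<close> for which, in this order,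
    a point meets a translated point, a line meets a translated line, a translated point falls on an
    old line, or an old point falls on a translated line.\<close>
  define X where "X = (\<lambda>(p, q). snd p - snd q) ` (A1 \<times> A2) \<union> (\<lambda>(l, m). snd m - snd l) ` (B1 \<times> B2)
     \<union> (\<lambda>(p, l). fst p * fst l - snd p - snd l) ` (A2 \<times> B1)
     \<union> (\<lambda>(p, l). snd p + snd l - fst p * fst l) ` (A1 \<times> B2)"
  have "finite X" using f by (auto simp: X_def)
  then obtain c where c: "c \<notin> X" using ex_new_if_finite infinite_UNIV_char_0 by blast
  define F G where "F = (\<lambda>p::pair. (fst p, snd p + c))" and "G = (\<lambda>l::pair. (fst l, snd l - c))"
  have injF: "inj_on F U" and injG: "inj_on G U" for U by (auto simp: F_def G_def inj_on_def prod_eq_iff)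
  have FG: "inc (F p) (G l) \<longleftrightarrow> inc p l" "inc (G l) (F p) \<longleftrightarrow> inc l p" for p l
    by (auto simp: inc_def F_def G_def)
  have dA: "A1 \<inter> F ` A2 = {}"
  proof -
    have "p \<noteq> F q" if "p \<in> A1" "q \<in> A2" for p q
    proof
      assume "p = F q"
      hence "c = snd p - snd q" by (simp add: F_def)
      hence "c \<in> X" unfolding X_def using that by (intro UnI1) (rule image_eqI[of _ _ "(p, q)"], auto)
      thus False using c by simp
    qed
    thus ?thesis by auto
  qed
  have dB: "B1 \<inter> G ` B2 = {}"
  proof -
    have "l \<noteq> G m" if "l \<in> B1" "m \<in> B2" for l m
    proof
      assume "l = G m"
      hence "c = snd m - snd l" by (simp add: G_def)
      hence "c \<in> X" unfolding X_def using that
        by (intro UnI1[OF UnI1[OF UnI2]]) (rule image_eqI[of _ _ "(l, m)"], auto)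
      thus False using c by simp
    qed
    thus ?thesis by auto
  qed
  have no1: "\<not> inc (F p) l" if "p \<in> A2" "l \<in> B1" for p l
  proof
    assume "inc (F p) l"
    hence "c = fst p * fst l - snd p - snd l" by (simp add: inc_def F_def)
    hence "c \<in> X" unfolding X_def using that
      by (intro UnI1[OF UnI2]) (rule image_eqI[of _ _ "(p, l)"], auto)
    thus False using c by simp
  qed
  have no2: "\<not> inc p (G l)" if "p \<in> A1" "l \<in> B2" for p l
  proof
    assume "inc p (G l)"
    hence "c = snd p + snd l - fst p * fst l" by (simp add: inc_def G_def)
    hence "c \<in> X" unfolding X_def using that
      by (intro UnI2) (rule image_eqI[of _ _ "(p, l)"], auto)
    thus False using c by simp
  qed
  have d: "{p \<in> A1 \<union> F ` A2. inc p l} = {p \<in> A1. inc p l}" if "l \<in> B1" for l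
    using no1 that by blast
  have d': "{p \<in> A1 \<union> F ` A2. inc p (G l)} = F ` {p \<in> A2. inc p l}" if "l \<in> B2" for l
    using no2 that FG by blast
  have e: "{l \<in> B1 \<union> G ` B2. inc l p} = {l \<in> B1. inc l p}" if "p \<in> A1" for p
    using no2 that inc_commute by blast
  have e': "{l \<in> B1 \<union> G ` B2. inc l (F p)} = G ` {l \<in> B2. inc l p}" if "p \<in> A2" for p
    using no1 that FG inc_commute by blast
  have "slope_configuration (n1 + n2) k (A1 \<union> F ` A2) (B1 \<union> G ` B2)"
    unfolding slope_configuration_def deg_def
  proof (intro conjI ballI)
    show "card (A1 \<union> F ` A2) = n1 + n2" "card (B1 \<union> G ` B2) = n1 + n2"
      using f dA dB by (simp_all add: card_Un_disjoint card_image injF injG)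
  next
    fix l assume "l \<in> B1 \<union> G ` B2"
    thus "card {p \<in> A1 \<union> F ` A2. inc p l} = k"
      using f by (elim UnE imageE) (simp_all add: d d' card_image injF deg_def del: Un_iff)
  next
    fix p assume "p \<in> A1 \<union> F ` A2"
    thus "card {l \<in> B1 \<union> G ` B2. inc l p} = k"
      using f by (elim UnE imageE) (simp_all add: e e' card_image injG deg_def del: Un_iff)
  qed (use f in auto)
  thus ?thesis by blast
qed

subsection \<open>Six copies of a near configuration\<close>

text \<open>The horizontal line through the six copies of \<open>p\<close> is the pair \<open>(0, - snd p)\<close>; dually, the six
  copies of the line \<open>l\<close> meet in \<open>(0, - snd l)\<close>. Lines are scaled by \<open>1 / s\<close> when points are scaled
  by \<open>s\<close>.\<close>

definition copies :: "real \<Rightarrow> pair set \<Rightarrow> pair set \<Rightarrow> pair set" where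
  "copies s A B = (\<lambda>(j, p). (s ^ j * fst p, snd p)) ` ({..<6::nat} \<times> A)
     \<union> (\<lambda>l. (0, - snd l)) ` {l \<in> B. deg A l = 5}"

lemma copies_cases:
  assumes "q \<in> copies s A B"
  obtains (old) i p where "i < 6" "p \<in> A" "q = (s ^ i * fst p, snd p)"
    | (new) l where "l \<in> B" "deg A l = 5" "q = (0, - snd l)"
  using assms unfolding copies_def
proof (elim UnE imageE)
  fix x assume "q = (case x of (j, p) \<Rightarrow> (s ^ j * fst p, snd p))" "x \<in> {..<6} \<times> A"
  thus thesis using old[of "fst x" "snd x"] by (simp add: case_prod_beta mem_Times_iff)
next
  fix l assume "q = (0, - snd l)" "l \<in> {l \<in> B. deg A l = 5}"
  thus thesis using new by blast
qed

lemma old_in_copies: "i < 6 \<Longrightarrow> p \<in> A \<Longrightarrow> (s ^ i * fst p, snd p) \<in> copies s A B"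
  unfolding copies_def by (rule UnI1, rule image_eqI[of _ _ "(i, p)"]) simp_all

lemma new_in_copies: "l \<in> B \<Longrightarrow> deg A l = 5 \<Longrightarrow> (0, - snd l) \<in> copies s A B"
  unfolding copies_def by blast

text \<open>Nonzero first coordinates and distinct powers of \<open>s\<close> keep the six copies
  apart and off the axis. Injectivity of \<open>snd\<close> keeps the added elements distinct and
  incident with the copies of one element only. \<open>snd p + snd l \<noteq> 0\<close> says that
  the added point \<open>(0, - snd l)\<close> is not on the added line \<open>(0, - snd p)\<close>.
  The last clause forbids incidences between copies with different exponents.\<close>

definition general :: "real \<Rightarrow> pair set \<Rightarrow> pair set \<Rightarrow> bool" where
  "general s A B \<longleftrightarrow> (\<forall>p\<in>A. fst p \<noteq> 0) \<and> (\<forall>l\<in>B. fst l \<noteq> 0) \<and>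
     inj_on snd A \<and> inj_on snd B \<and> (\<forall>p\<in>A. \<forall>l\<in>B. snd p + snd l \<noteq> 0) \<and> s > 0 \<and>
     (\<forall>i<6::nat. \<forall>j<6::nat. i \<noteq> j \<longrightarrow> s ^ i \<noteq> s ^ j \<and>
       (\<forall>p\<in>A. \<forall>l\<in>B. snd p + snd l \<noteq> s ^ i / s ^ j * (fst p * fst l)))"

lemma
  assumes "general s A B"
  shows general_fst: "p \<in> A \<Longrightarrow> fst p \<noteq> 0" "l \<in> B \<Longrightarrow> fst l \<noteq> 0"
    and general_inj: "p \<in> A \<Longrightarrow> q \<in> A \<Longrightarrow> snd p = snd q \<Longrightarrow> p = q"
      "l \<in> B \<Longrightarrow> m \<in> B \<Longrightarrow> snd l = snd m \<Longrightarrow> l = m"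
    and general_snd: "p \<in> A \<Longrightarrow> l \<in> B \<Longrightarrow> snd p + snd l \<noteq> 0"
    and general_pos: "s > 0"
    and general_power: "i < 6 \<Longrightarrow> j < 6 \<Longrightarrow> s ^ i = s ^ j \<Longrightarrow> i = j"
    and general_ratio: "i < 6 \<Longrightarrow> j < 6 \<Longrightarrow> i \<noteq> j \<Longrightarrow> p \<in> A \<Longrightarrow> l \<in> B \<Longrightarrow>
      snd p + snd l \<noteq> s ^ i / s ^ j * (fst p * fst l)"
  using assms unfolding general_def inj_on_def by blast+

text \<open>Replacing \<open>s\<close> by \<open>1 / s\<close> exchanges the exponents
  \<open>i\<close> and \<open>j\<close> in the ratio. Each statement about the copied points thereby
  also holds for the copied lines.\<close>

lemma general_commute:
  assumes "general s A B"
  shows "general (1 / s) B A"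
proof -
  have "snd l + snd p \<noteq> (1 / s) ^ i / (1 / s) ^ j * (fst l * fst p)"
    if "p \<in> A" "l \<in> B" "i < 6" "j < 6" "i \<noteq> j" for p l i j
  proof -
    have "snd p + snd l \<noteq> s ^ j / s ^ i * (fst p * fst l)" "s > 0"
      using general_ratio[OF assms, of j i p l] general_pos[OF assms] that by auto
    thus ?thesis by (simp add: power_one_over field_simps)
  qed
  moreover have "(1 / s) ^ i \<noteq> (1 / s) ^ j" if "i < 6" "j < 6" "i \<noteq> j" for i j :: nat
    using general_power[OF assms, of i j] general_pos[OF assms] that
    by (auto simp: power_one_over)
  ultimately show ?thesis
    using assms unfolding general_def by (intro conjI) (blast, blast, blast, blast, metis add.commute, simp, blast)
qed

context
  fixes s :: real and A B :: "pair set"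
  assumes fin: "finite A" "finite B" and gen: "general s A B"
begin

lemma inj_on_copy: "inj_on (\<lambda>(j, p). (s ^ j * fst p, snd p)) ({..<6::nat} \<times> A)"
proof (rule inj_onI, clarsimp)
  fix i j :: nat and x y x' assume *: "i < 6" "(x, y) \<in> A" "j < 6" "(x', y) \<in> A" "s ^ i * x = s ^ j * x'"
  have "x = x'" using general_inj(1)[OF gen *(2,4)] by simp
  moreover have "x \<noteq> 0" using general_fst(1)[OF gen *(2)] by simp
  ultimately have "s ^ i = s ^ j" using * by simp
  thus "i = j \<and> x = x'" using general_power[OF gen *(1,3)] \<open>x = x'\<close> by simp
qed

lemma finite_copies: "finite (copies s A B)"
  using fin by (simp add: copies_def)

lemma card_copies: "card (copies s A B) = 6 * card A + card {l \<in> B. deg A l = 5}"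
proof -
  have "inj_on (\<lambda>l. (0::real, - snd l)) {l \<in> B. deg A l = 5}"
    by (rule inj_onI) (use general_inj(2)[OF gen] in simp)
  moreover have "(\<lambda>(j, p). (s ^ j * fst p, snd p)) ` ({..<6::nat} \<times> A) \<inter>
      (\<lambda>l. (0, - snd l)) ` {l \<in> B. deg A l = 5} = {}"
  proof -
    have "fst q \<noteq> 0" if "q \<in> (\<lambda>(j, p). (s ^ j * fst p, snd p)) ` ({..<6::nat} \<times> A)" for q
      using that general_fst(1)[OF gen] general_pos[OF gen] by (elim imageE) (simp add: case_prod_beta mem_Times_iff)
    moreover have "fst q = 0" if "q \<in> (\<lambda>l. (0, - snd l)) ` {l \<in> B. deg A l = 5}" for q
      using that by (elim imageE) simp
    ultimately show ?thesis by blast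
  qed
  ultimately show ?thesis
    using fin unfolding copies_def
    by (subst card_Un_disjoint) (simp_all add: card_image inj_on_copy card_cartesian_product)
qed

text \<open>A copied line meets exactly the copies of its own points with the same exponent, and one
  axis point in addition iff its degree was 5. An added horizontal line meets exactly the six copies
  of its point.\<close>

lemma deg_copies:
  assumes deg: "\<forall>l\<in>B. deg A l \<in> {5, 6}" and l': "l' \<in> copies (1 / s) B A"
  shows "deg (copies s A B) l' = 6"
proof -
  have s: "s > 0" using general_pos[OF gen] .
  consider (old) j l where "j < 6" "l \<in> B" "l' = ((1 / s) ^ j * fst l, snd l)"
    | (new) p where "p \<in> A" "deg B p = 5" "l' = (0, - snd p)"
    using l' by (rule copies_cases)
  thus ?thesis
  proof cases
    case old
    \<comment> \<open>Equal exponents cancel in the product of the first coordinates; unequal ones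
      are excluded by the ratio clause of \<open>general\<close>.\<close>
    have eq: "inc (s ^ i * fst p, snd p) l' \<longleftrightarrow> i = j \<and> inc p l" if "p \<in> A" "i < 6" for p i
    proof (cases "i = j")
      case True
      thus ?thesis using old s by (simp add: inc_def power_one_over)
    next
      case False
      hence "snd p + snd l \<noteq> s ^ i / s ^ j * (fst p * fst l)"
        using general_ratio[OF gen] old that by blast
      thus ?thesis using False old s by (simp add: inc_def power_one_over field_simps)
    qed
    \<comment> \<open>On the axis the incidence equation reduces to \<open>snd l = snd m\<close>,
      and \<open>snd\<close> is injective on \<open>B\<close>.\<close>
    have ax: "inc (0, - snd m) l' \<longleftrightarrow> m = l" if "m \<in> B" for m
      using general_inj(2)[OF gen old(2) that] old by (auto simp: inc_def)
    let ?X = "(\<lambda>p. (s ^ j * fst p, snd p)) ` {p \<in> A. inc p l}"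
    let ?Y = "if deg A l = 5 then {(0, - snd l)} else {} :: pair set"
    have "{p \<in> copies s A B. inc p l'} = ?X \<union> ?Y"
    proof (intro equalityI subsetI)
      fix q assume q: "q \<in> {p \<in> copies s A B. inc p l'}"
      then consider (a) i p where "i < 6" "p \<in> A" "q = (s ^ i * fst p, snd p)"
        | (b) m where "m \<in> B" "deg A m = 5" "q = (0, - snd m)"
        using copies_cases by blast
      thus "q \<in> ?X \<union> ?Y"
      proof cases
        case a
        hence "i = j" "inc p l" using q eq by blast+
        thus ?thesis using a by blast
      next
        case b
        hence "m = l" using q ax by blast
        thus ?thesis using b by simp
      qed
    next
      fix q assume "q \<in> ?X \<union> ?Y"
      then consider (a) p where "p \<in> A" "inc p l" "q = (s ^ j * fst p, snd p)"
        | (b) "deg A l = 5" "q = (0, - snd l)"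
        by (auto split: if_splits)
      thus "q \<in> {p \<in> copies s A B. inc p l'}"
      proof cases
        case a
        thus ?thesis using old_in_copies[of j p] eq[of p j] old by simp
      next
        case b
        thus ?thesis using old ax new_in_copies[of l B A s] by simp
      qed
    qed
    hence "deg (copies s A B) l' = card (?X \<union> ?Y)" by (simp only: deg_def[of "copies s A B"])
    also have "\<dots> = card ?X + card ?Y"
      by (rule card_Un_disjoint) (use fin general_fst(1)[OF gen] s in auto)
    also have "card ?X = deg A l"
    proof -
      have "inj_on (\<lambda>p. (s ^ j * fst p, snd p)) {p \<in> A. inc p l}"
        using s by (auto simp: inj_on_def prod_eq_iff)
      thus ?thesis by (simp add: card_image deg_def)
    qed
    finally have "deg (copies s A B) l' = deg A l + card ?Y" .
    thus ?thesis using deg old by auto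
  next
    case new
    have "{q \<in> copies s A B. inc q l'} = (\<lambda>j. (s ^ j * fst p, snd p)) ` {..<6}"
    proof (intro equalityI subsetI)
      fix q assume q: "q \<in> {p \<in> copies s A B. inc p l'}"
      then consider (a) i p' where "i < 6" "p' \<in> A" "q = (s ^ i * fst p', snd p')"
        | (b) m where "m \<in> B" "deg A m = 5" "q = (0, - snd m)"
        using copies_cases by blast
      thus "q \<in> (\<lambda>j. (s ^ j * fst p, snd p)) ` {..<6}"
      proof cases
        case a
        hence "snd p' = snd p" using q new by (simp add: inc_def)
        hence "p' = p" using general_inj(1)[OF gen] a new by blast
        thus ?thesis using a by auto
      next
        case b
        hence "snd p + snd m = 0" using q new by (simp add: inc_def)
        thus ?thesis using general_snd[OF gen] b new by blast
      qed
    next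
      fix q assume "q \<in> (\<lambda>j. (s ^ j * fst p, snd p)) ` {..<6}"
      then obtain j where j: "j < 6" "q = (s ^ j * fst p, snd p)" by auto
      have "q \<in> copies s A B" using j new old_in_copies by blast
      thus "q \<in> {p \<in> copies s A B. inc p l'}" using j new by (simp add: inc_def)
    qed
    moreover have "inj_on (\<lambda>j. (s ^ j * fst p, snd p)) {..<6}"
    proof (rule inj_onI)
      fix i j :: nat
      assume "i \<in> {..<6}" "j \<in> {..<6}" "(s ^ i * fst p, snd p) = (s ^ j * fst p, snd p)"
      moreover have "fst p \<noteq> 0" using general_fst(1)[OF gen] new by blast
      ultimately have "i < 6" "j < 6" "s ^ i = s ^ j" by auto
      thus "i = j" using general_power[OF gen] by blast
    qed
    ultimately show ?thesis by (simp add: deg_def card_image)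
  qed
qed

end

section \<open>Near configurations and their reduction to general position\<close>

definition near_configuration :: "pair set \<Rightarrow> pair set \<Rightarrow> bool" where
  "near_configuration A B \<longleftrightarrow> finite A \<and> finite B \<and>
     (\<forall>l\<in>B. deg A l \<in> {5, 6}) \<and> (\<forall>p\<in>A. deg B p \<in> {5, 6})"

lemma slope_configuration_copies:
  assumes near: "near_configuration A B" and gen: "general s A B"
    and n: "6 * card A + card {l \<in> B. deg A l = 5} = n" "6 * card B + card {p \<in> A. deg B p = 5} = n"
  shows "slope_configuration n 6 (copies s A B) (copies (1 / s) B A)"
proof -
  note gen' = general_commute[OF gen]
  have fin: "finite A" "finite B" using near by (simp_all add: near_configuration_def)
  have d: "\<forall>l\<in>B. deg A l \<in> {5, 6}" "\<forall>p\<in>A. deg B p \<in> {5, 6}"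
    using near by (simp_all add: near_configuration_def)
  \<comment> \<open>Exchanging points and lines applies the construction with \<open>1 / s\<close>,
    whose dual side then carries \<open>1 / (1 / s)\<close>.\<close>
  have s: "1 / (1 / s) = s" by simp
  show ?thesis
    unfolding slope_configuration_def
    using finite_copies[OF fin gen] finite_copies[OF fin(2,1) gen'] card_copies[OF fin gen]
      card_copies[OF fin(2,1) gen'] deg_copies[OF fin gen d(1)]
      deg_copies[OF fin(2,1) gen' d(2), unfolded s] n
    by (intro conjI ballI) (assumption | simp)+
qed

text \<open>\<open>F\<close> is the shear \<open>y -> y + a x\<close> followed by the shift
  \<open>x -> x + b\<close>, and \<open>G\<close> is its action on slopes and intercepts, so
  incidence is kept for every \<open>a\<close> and \<open>b\<close>. Each failure of general
  position fixes \<open>a\<close>, or fixes \<open>b\<close> once \<open>a\<close> is known. Finally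
  \<open>s\<close> is taken larger than all ratios that a power of \<open>s\<close> must avoid and
  larger than their inverses.\<close>

lemma ex_shear_general:
  assumes fin: "finite A" "finite B"
  shows "\<exists>F G s. inj F \<and> inj G \<and> (\<forall>p l. inc (F p) (G l) \<longleftrightarrow> inc p l) \<and> general s (F ` A) (G ` B)"
proof -
  have new: "\<exists>c::real. c \<notin> X" if "finite X" for X
    using ex_new_if_finite[OF infinite_UNIV_char_0 that] .
  \<comment> \<open>Outside \<open>X1\<close> all new slopes are nonzero; outside \<open>X2\<close>
    the new heights of the points are distinct. Pairs with equal first coordinates need no
    exclusion: for them \<open>x / 0 = 0\<close> at most forbids \<open>a = 0\<close> as
    well.\<close>
  define X1 X2 where "X1 = (\<lambda>l. - fst l) ` B"
    and "X2 = (\<lambda>(p, q). - (snd p - snd q) / (fst p - fst q)) ` (A \<times> A)"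
  have "finite (X1 \<union> X2)" using fin by (simp add: X1_def X2_def)
  from new[OF this] obtain a where a: "a \<notin> X1" "a \<notin> X2" by blast
  \<comment> \<open>\<open>Y1\<close> and \<open>Y2\<close> are the dual conditions, on abscissae of
    points and intercepts of lines. \<open>Y3\<close> keeps added points off added lines; its
    denominators are nonzero by the choice of \<open>a\<close>, which is why \<open>a\<close> is
    fixed first.\<close>
  define Y1 Y2 Y3 where "Y1 = (\<lambda>p. - fst p) ` A"
    and "Y2 = (\<lambda>(l, m). - (snd l - snd m) / (fst l - fst m)) ` (B \<times> B)"
    and "Y3 = (\<lambda>(p, l). - (snd p + a * fst p + snd l) / (fst l + a)) ` (A \<times> B)"
  have "finite (Y1 \<union> Y2 \<union> Y3)" using fin by (simp add: Y1_def Y2_def Y3_def)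
  from new[OF this] obtain b where b: "b \<notin> Y1" "b \<notin> Y2" "b \<notin> Y3" by blast
  define F where "F = (\<lambda>p::pair. (fst p + b, snd p + a * fst p))"
  define G where "G = (\<lambda>l::pair. (fst l + a, snd l + b * (fst l + a)))"
  have inc: "inc (F p) (G l) \<longleftrightarrow> inc p l" for p l
    by (simp add: inc_def F_def G_def algebra_simps)
  have inj: "inj F" "inj G" by (auto simp: inj_def F_def G_def)
  have 1: "fst l + a \<noteq> 0" if "l \<in> B" for l
  proof
    assume "fst l + a = 0" hence "a = - fst l" by simp
    thus False using a(1) that unfolding X1_def by blast
  qed
  have 2: "fst p + b \<noteq> 0" if "p \<in> A" for p
  proof
    assume "fst p + b = 0" hence "b = - fst p" by simp
    thus False using b(1) that unfolding Y1_def by blast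
  qed
  have 3: "p = q" if "p \<in> A" "q \<in> A" "snd p + a * fst p = snd q + a * fst q" for p q
  proof (cases "fst p = fst q")
    case True thus ?thesis using that by (simp add: prod_eq_iff)
  next
    case False
    hence "a = - (snd p - snd q) / (fst p - fst q)" using that by (simp add: field_simps)
    hence "a \<in> X2" unfolding X2_def using that by (intro image_eqI[of _ _ "(p, q)"]) simp_all
    thus ?thesis using a(2) by blast
  qed
  have 4: "l = m" if "l \<in> B" "m \<in> B" "snd l + b * (fst l + a) = snd m + b * (fst m + a)" for l m
  proof (cases "fst l = fst m")
    case True thus ?thesis using that by (simp add: prod_eq_iff)
  next
    case False
    hence "b = - (snd l - snd m) / (fst l - fst m)" using that by (simp add: field_simps)
    hence "b \<in> Y2" unfolding Y2_def using that by (intro image_eqI[of _ _ "(l, m)"]) simp_all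
    thus ?thesis using b(2) by blast
  qed
  have 5: "snd p + a * fst p + (snd l + b * (fst l + a)) \<noteq> 0" if "p \<in> A" "l \<in> B" for p l
  proof
    assume "snd p + a * fst p + (snd l + b * (fst l + a)) = 0"
    hence "b = - (snd p + a * fst p + snd l) / (fst l + a)"
      using 1[OF that(2)] by (simp add: field_simps)
    hence "b \<in> Y3" unfolding Y3_def using that by (intro image_eqI[of _ _ "(p, l)"]) simp_all
    thus False using b(3) by blast
  qed
  \<comment> \<open>These are the values that \<open>s ^ i / s ^ j\<close> must not take for
    \<open>i \<noteq> j\<close>. Adjoining the inverses handles \<open>i < j\<close>, where the
    quotient is the inverse of a positive power of \<open>s\<close>.\<close>
  define R where "R = (\<lambda>(p, l). (snd p + snd l) / (fst p * fst l)) ` (F ` A \<times> G ` B)"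
  have "finite (R \<union> inverse ` R)" using fin by (simp add: R_def)
  then obtain M where M: "\<forall>c\<in>R \<union> inverse ` R. c \<le> M"
    using bdd_above_finite unfolding bdd_above_def by blast
  define s where "s = max M 1 + 1"
  have s1: "s > 1" by (simp add: s_def)
  have s2: "c < s" if "c \<in> R \<union> inverse ` R" for c
  proof -
    have "c \<le> M" using M that by blast
    thus ?thesis by (simp add: s_def)
  qed
  have s3: "s \<le> s ^ d" if "d > 0" for d using s1 that by (simp add: self_le_power)
  have 6: "s ^ i / s ^ j \<notin> R" if "i \<noteq> j" for i j
  proof (cases "i < j")
    case True
    hence "s ^ i / s ^ j = inverse (s ^ (j - i))" using s1 by (simp add: power_diff field_simps)
    moreover have "s ^ (j - i) \<notin> inverse ` R"
      using s2[of "s ^ (j - i)"] s3[of "j - i"] True by auto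
    ultimately show ?thesis by (metis image_eqI inverse_inverse_eq)
  next
    case False
    hence "s ^ i / s ^ j = s ^ (i - j)" using s1 by (simp add: power_diff)
    thus ?thesis using s2[of "s ^ (i - j)"] s3[of "i - j"] False that by auto
  qed
  have 7: "snd p + snd l \<noteq> s ^ i / s ^ j * (fst p * fst l)"
    if "i \<noteq> j" "p \<in> F ` A" "l \<in> G ` B" for i j p l
  proof
    assume "snd p + snd l = s ^ i / s ^ j * (fst p * fst l)"
    moreover have "fst p \<noteq> 0" "fst l \<noteq> 0" using 1 2 that by (auto simp: F_def G_def)
    ultimately have "s ^ i / s ^ j = (snd p + snd l) / (fst p * fst l)" by (simp add: field_simps)
    hence "s ^ i / s ^ j \<in> R" unfolding R_def
      using that by (intro image_eqI[of _ _ "(p, l)"]) simp_all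
    thus False using 6 that by blast
  qed
  have "general s (F ` A) (G ` B)"
    unfolding general_def
  proof (intro conjI)
    show "\<forall>p\<in>F ` A. fst p \<noteq> 0" "\<forall>l\<in>G ` B. fst l \<noteq> 0" using 1 2 by (simp_all add: F_def G_def)
    show "inj_on snd (F ` A)" "inj_on snd (G ` B)"
      using 3 4 by (auto intro!: inj_onI simp: F_def G_def simp del: split_paired_All)
    show "\<forall>p\<in>F ` A. \<forall>l\<in>G ` B. snd p + snd l \<noteq> 0" using 5 by (simp add: F_def G_def)
    show "s > 0" using s1 by linarith
    show "\<forall>i<6. \<forall>j<6. i \<noteq> j \<longrightarrow> s ^ i \<noteq> s ^ j \<and>
       (\<forall>p\<in>F ` A. \<forall>l\<in>G ` B. snd p + snd l \<noteq> s ^ i / s ^ j * (fst p * fst l))"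
      using 7 power_inject_exp[OF s1] by blast
  qed
  thus ?thesis using inc inj by blast
qed

text \<open>\<open>F\<close> and \<open>G\<close> are injective and respect incidence, so all
  degrees survive the passage to general position.\<close>

lemma near_configuration_imp_slope_configuration:
  assumes near: "near_configuration A B"
    and n: "6 * card A + card {l \<in> B. deg A l = 5} = n" "6 * card B + card {p \<in> A. deg B p = 5} = n"
  shows "\<exists>A' B'. slope_configuration n 6 A' B'"
proof -
  have fin: "finite A" "finite B" using near by (simp_all add: near_configuration_def)
  obtain F G s where FG: "inj F" "inj G" "\<forall>p l. inc (F p) (G l) \<longleftrightarrow> inc p l"
      and gen: "general s (F ` A) (G ` B)" using ex_shear_general[OF fin] by blast
  have i: "inj_on F U" "inj_on G V" for U V using FG by (meson inj_on_subset subset_UNIV)+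
  have "{p \<in> F ` A. inc p (G l)} = F ` {p \<in> A. inc p l}" for l using FG(3) by blast
  hence 1: "deg (F ` A) (G l) = deg A l" for l by (simp add: deg_def card_image i)
  have "{l \<in> G ` B. inc l (F p)} = G ` {l \<in> B. inc l p}" for p using FG(3) inc_commute by blast
  hence 2: "deg (G ` B) (F p) = deg B p" for p by (simp add: deg_def card_image i)
  have "{l \<in> G ` B. deg (F ` A) l = 5} = G ` {l \<in> B. deg A l = 5}"
    "{p \<in> F ` A. deg (G ` B) p = 5} = F ` {p \<in> A. deg B p = 5}" using 1 2 by auto
  moreover have "near_configuration (F ` A) (G ` B)"
    using near 1 2 by (simp add: near_configuration_def)
  ultimately have "slope_configuration n 6 (copies s (F ` A) (G ` B)) (copies (1 / s) (G ` B) (F ` A))"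
    using gen n by (intro slope_configuration_copies) (simp_all add: card_image i)
  thus ?thesis by blast
qed

subsection \<open>Testing explicit near configurations\<close>

text \<open>An entry \<open>(k, i, e)\<close> is a point or line \<open>e\<close> with label \<open>i\<close> that is present at the stages \<open>j < k\<close>
  of a chain of removals. The lists of entries are cut into pieces because the simplifier
  traverses the rest of a list at every step, which is costly for long lists. Equal points would
  have equal rows, so that distinct rows show that no point or line is listed twice.\<close>

definition row :: "('e \<Rightarrow> 'e \<Rightarrow> bool) \<Rightarrow> (int \<times> int \<times> 'e) list list \<Rightarrow> 'e \<Rightarrow> (int \<times> int) list" where
  "row t yss e = concat (map (\<lambda>ys. map (\<lambda>(k, i, f). (k, i)) (filter (\<lambda>(k, i, f). t e f) ys)) yss)"

text \<open>All stages of a chain are read off this one incidence table: passing to a later stage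
  only compares indices \<open>k\<close>, without any further arithmetic on coordinates.\<close>

definition rows :: "('e \<Rightarrow> 'e \<Rightarrow> bool) \<Rightarrow> (int \<times> int \<times> 'e) list list \<Rightarrow> (int \<times> int \<times> 'e) list list \<Rightarrow>
    (int \<times> (int \<times> int) list) list" where
  "rows t xss yss = concat (map (\<lambda>xs. map (\<lambda>(k, i, e). (k, row t yss e)) xs) xss)"

definition stage_deg :: "int \<Rightarrow> (int \<times> int) list \<Rightarrow> nat" where
  "stage_deg j r = length (filter (\<lambda>(k, i). j < k) r)"

definition stage_ok :: "int \<Rightarrow> (int \<times> (int \<times> int) list) list \<Rightarrow> bool" where
  "stage_ok j rs \<longleftrightarrow> list_all (\<lambda>(k, r). j < k \<longrightarrow> stage_deg j r = 5 \<or> stage_deg j r = 6) rs"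

text \<open>With points first and lines second this is the number of points of the resulting
  six-fold configuration; with the arguments exchanged it is the number of lines.
  \<open>check_rows\<close> asks for the same \<open>n\<close> both times.\<close>

definition stage_value :: "int \<Rightarrow> (int \<times> (int \<times> int) list) list \<Rightarrow> (int \<times> (int \<times> int) list) list \<Rightarrow> nat" where
  "stage_value j rs ss = 6 * length (filter (\<lambda>(k, r). j < k) rs) +
     length (filter (\<lambda>(k, r). j < k \<and> stage_deg j r = 5) ss)"

definition check_rows :: "(int \<times> nat) list \<Rightarrow> (int \<times> (int \<times> int) list) list \<Rightarrow>
    (int \<times> (int \<times> int) list) list \<Rightarrow> bool" where
  "check_rows js rs ss \<longleftrightarrow> distinct (map snd rs) \<and> distinct (map snd ss) \<and>
     list_all (\<lambda>(j, n). stage_ok j rs \<and> stage_ok j ss \<and>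
       stage_value j rs ss = n \<and> stage_value j ss rs = n) js"

definition check :: "('e \<Rightarrow> 'e \<Rightarrow> bool) \<Rightarrow> ('e \<Rightarrow> bool) \<Rightarrow> (int \<times> nat) list \<Rightarrow>
    (int \<times> int \<times> 'e) list list \<Rightarrow> (int \<times> int \<times> 'e) list list \<Rightarrow> bool" where
  "check t proper js pss lss \<longleftrightarrow>
     list_all (list_all (\<lambda>(k, i, e). proper e)) pss \<and> list_all (list_all (\<lambda>(k, i, e). proper e)) lss \<and>
     check_rows js (rows t pss lss) (rows t lss pss)"

section \<open>Correctness of the test on lists\<close>

abbreviation elem :: "int \<times> int \<times> 'e \<Rightarrow> 'e" where
  "elem x \<equiv> snd (snd x)"

lemma row_eq: "row t yss e = map (\<lambda>y. (fst y, fst (snd y))) (filter (\<lambda>y. t e (elem y)) (concat yss))"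
  by (simp add: row_def filter_concat map_concat case_prod_unfold comp_def)

lemma rows_eq: "rows t xss yss = map (\<lambda>x. (fst x, row t yss (elem x))) (concat xss)"
  by (simp add: rows_def map_concat case_prod_unfold comp_def)

definition stage_set :: "('e \<Rightarrow> pair) \<Rightarrow> (int \<times> int \<times> 'e) list list \<Rightarrow> int \<Rightarrow> pair set" where
  "stage_set pt xss j = (\<lambda>x. pt (elem x)) ` {x \<in> set (concat xss). j < fst x}"

lemma finite_stage_set: "finite (stage_set pt xss j)"
  by (simp add: stage_set_def)

context
  fixes t :: "'e \<Rightarrow> 'e \<Rightarrow> bool" and proper :: "'e \<Rightarrow> bool" and pt :: "'e \<Rightarrow> pair"
  assumes test: "\<And>e f. proper e \<Longrightarrow> proper f \<Longrightarrow> t e f \<longleftrightarrow> inc (pt e) (pt f)"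
begin

context
  fixes xss yss :: "(int \<times> int \<times> 'e) list list"
  assumes proper: "\<And>x. x \<in> set (concat xss) \<Longrightarrow> proper (elem x)" "\<And>y. y \<in> set (concat yss) \<Longrightarrow> proper (elem y)"
    and distinct: "distinct (map snd (rows t xss yss))"
begin

lemma distinct_entries: "distinct (concat xss)"
  using distinct by (simp only: rows_eq map_map distinct_map)

text \<open>Homogeneous triples are not unique, so different entries might denote the same pair. On
  proper entries \<open>t\<close> depends only on the denoted pairs; equal pairs would thus have
  equal incidence rows, against their distinctness.\<close>

lemma inj_on_entries: "inj_on (\<lambda>x. pt (elem x)) (set (concat xss))"
proof (rule inj_onI)
  fix x y assume xy: "x \<in> set (concat xss)" "y \<in> set (concat xss)" "pt (elem x) = pt (elem y)"
  have "t (elem x) (elem z) \<longleftrightarrow> t (elem y) (elem z)" if "z \<in> set (concat yss)" for z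
    using test[OF proper(1)[OF xy(1)] proper(2)[OF that]] test[OF proper(1)[OF xy(2)] proper(2)[OF that]] xy(3)
    by simp
  hence "row t yss (elem x) = row t yss (elem y)"
    unfolding row_eq by (metis (mono_tags, lifting) filter_cong)
  moreover have "inj_on (\<lambda>x. row t yss (elem x)) (set (concat xss))"
    using distinct unfolding rows_eq map_map by (simp add: distinct_map comp_def)
  ultimately show "x = y" using xy(1,2) by (auto dest: inj_onD)
qed

lemma card_stage_subset:
  "card ((\<lambda>x. pt (elem x)) ` {x \<in> set (concat xss). Q x}) = length (filter Q (concat xss))"
proof -
  have "inj_on (\<lambda>x. pt (elem x)) {x \<in> set (concat xss). Q x}"
    using inj_on_entries by (rule inj_on_subset) blast
  hence "card ((\<lambda>x. pt (elem x)) ` {x \<in> set (concat xss). Q x}) = card (set (filter Q (concat xss)))"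
    by (simp add: card_image)
  also have "\<dots> = length (filter Q (concat xss))"
    by (intro distinct_card distinct_filter distinct_entries)
  finally show ?thesis .
qed

lemma deg_stage_set:
  assumes "y \<in> set (concat yss)"
  shows "deg (stage_set pt xss j) (pt (elem y)) = stage_deg j (row t xss (elem y))"
proof -
  have "inc (pt (elem x)) (pt (elem y)) \<longleftrightarrow> t (elem y) (elem x)" if "x \<in> set (concat xss)" for x
    using test[OF proper(2)[OF assms] proper(1)[OF that]] inc_commute by simp
  hence "{p \<in> stage_set pt xss j. inc p (pt (elem y))} =
      (\<lambda>x. pt (elem x)) ` {x \<in> set (concat xss). t (elem y) (elem x) \<and> j < fst x}"
    unfolding stage_set_def by blast
  thus ?thesis
    unfolding deg_def
    by (simp only: card_stage_subset) (simp add: stage_deg_def row_eq filter_map comp_def case_prod_unfold)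
qed

end

lemma check_imp_slope_configuration:
  assumes check: "check t proper js pss lss" and j: "(j, n) \<in> set js"
  shows "\<exists>A B. slope_configuration n 6 A B"
proof -
  have proper: "\<And>x. x \<in> set (concat pss) \<Longrightarrow> proper (elem x)" "\<And>x. x \<in> set (concat lss) \<Longrightarrow> proper (elem x)"
    using check by (auto simp: check_def list_all_iff case_prod_unfold)
  have cr: "check_rows js (rows t pss lss) (rows t lss pss)" using check by (simp add: check_def)
  have dist: "distinct (map snd (rows t pss lss))" "distinct (map snd (rows t lss pss))"
    using cr unfolding check_rows_def by blast+
  let ?A = "stage_set pt pss j" and ?B = "stage_set pt lss j"
  have "\<forall>(j, n)\<in>set js. stage_ok j (rows t pss lss) \<and> stage_ok j (rows t lss pss) \<and>
      stage_value j (rows t pss lss) (rows t lss pss) = n \<and>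
      stage_value j (rows t lss pss) (rows t pss lss) = n"
    by (rule conjunct2[OF conjunct2[OF cr[unfolded check_rows_def list_all_iff]]])
  from bspec[OF this j] have ok: "stage_ok j (rows t pss lss)" "stage_ok j (rows t lss pss)"
      "stage_value j (rows t pss lss) (rows t lss pss) = n"
      "stage_value j (rows t lss pss) (rows t pss lss) = n"
    by simp_all
  \<comment> \<open>The same lemma serves twice, with the point and line lists exchanged, because
    \<open>t\<close> is symmetric on proper entries.\<close>
  note P = deg_stage_set[OF proper dist(1)] and L = deg_stage_set[OF proper(2,1) dist(2)]
  have B: "deg ?A l \<in> {5, 6}" if "l \<in> ?B" for l
  proof -
    from that obtain y where y: "y \<in> set (concat lss)" "j < fst y" "l = pt (elem y)"
      unfolding stage_set_def by blast
    have "(fst y, row t pss (elem y)) \<in> set (rows t lss pss)" unfolding rows_eq using y by auto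
    thus ?thesis using ok(2) y P[of y j] unfolding stage_ok_def list_all_iff by fastforce
  qed
  have A: "deg ?B p \<in> {5, 6}" if "p \<in> ?A" for p
  proof -
    from that obtain y where y: "y \<in> set (concat pss)" "j < fst y" "p = pt (elem y)"
      unfolding stage_set_def by blast
    have "(fst y, row t lss (elem y)) \<in> set (rows t pss lss)" unfolding rows_eq using y by auto
    thus ?thesis using ok(1) y L[of y j] unfolding stage_ok_def list_all_iff by fastforce
  qed
  have cA: "card ?A = length (filter (\<lambda>(k, r). j < k) (rows t pss lss))"
    using card_stage_subset[OF proper dist(1), of "\<lambda>x. j < fst x"]
    by (simp add: stage_set_def rows_eq filter_map comp_def case_prod_unfold)
  have cB: "card ?B = length (filter (\<lambda>(k, r). j < k) (rows t lss pss))"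
    using card_stage_subset[OF proper(2,1) dist(2), of "\<lambda>x. j < fst x"]
    by (simp add: stage_set_def rows_eq filter_map comp_def case_prod_unfold)
  have "{l \<in> ?B. deg ?A l = 5} =
      (\<lambda>x. pt (elem x)) ` {y \<in> set (concat lss). j < fst y \<and> deg ?A (pt (elem y)) = 5}"
    unfolding stage_set_def[of pt lss] by blast
  also have "\<dots> =
      (\<lambda>x. pt (elem x)) ` {y \<in> set (concat lss). j < fst y \<and> stage_deg j (row t pss (elem y)) = 5}"
    by (intro image_cong Collect_cong conj_cong refl) (simp only: P)
  finally have dB: "card {l \<in> ?B. deg ?A l = 5} =
      length (filter (\<lambda>(k, r). j < k \<and> stage_deg j r = 5) (rows t lss pss))"
    unfolding rows_eq by (simp only: card_stage_subset[OF proper(2,1) dist(2)]) (simp add: filter_map comp_def case_prod_unfold)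
  have "{p \<in> ?A. deg ?B p = 5} =
      (\<lambda>x. pt (elem x)) ` {y \<in> set (concat pss). j < fst y \<and> deg ?B (pt (elem y)) = 5}"
    unfolding stage_set_def[of pt pss] by blast
  also have "\<dots> =
      (\<lambda>x. pt (elem x)) ` {y \<in> set (concat pss). j < fst y \<and> stage_deg j (row t lss (elem y)) = 5}"
    by (intro image_cong Collect_cong conj_cong refl) (simp only: L)
  finally have dA: "card {p \<in> ?A. deg ?B p = 5} =
      length (filter (\<lambda>(k, r). j < k \<and> stage_deg j r = 5) (rows t pss lss))"
    unfolding rows_eq by (simp only: card_stage_subset[OF proper dist(1)]) (simp add: filter_map comp_def case_prod_unfold)
  have "near_configuration ?A ?B"
    unfolding near_configuration_def
    using A B finite_stage_set by blast
  moreover have "6 * card ?A + card {l \<in> ?B. deg ?A l = 5} = n"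
    using ok(3) unfolding stage_value_def cA dB .
  moreover have "6 * card ?B + card {p \<in> ?A. deg ?B p = 5} = n"
    using ok(4) unfolding stage_value_def cB dA .
  ultimately show ?thesis by (rule near_configuration_imp_slope_configuration)
qed

end

section \<open>Exact incidence tests over Q and Q(sqrt d)\<close>

fun rat_test :: "int \<times> int \<times> int \<Rightarrow> int \<times> int \<times> int \<Rightarrow> bool" where
  "rat_test (u, v, w) (x, y, z) \<longleftrightarrow> v * z + w * y = u * x"

fun rat_proper :: "int \<times> int \<times> int \<Rightarrow> bool" where
  "rat_proper (u, v, w) \<longleftrightarrow> w \<noteq> 0"

fun rat_pair :: "int \<times> int \<times> int \<Rightarrow> pair" where
  "rat_pair (u, v, w) = (of_int u / of_int w, of_int v / of_int w)"

text \<open>The test is the incidence equation multiplied by both denominators, so that evaluation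
  stays within the integers.\<close>

lemma rat_test_iff_inc:
  assumes "rat_proper e" "rat_proper f"
  shows "rat_test e f \<longleftrightarrow> inc (rat_pair e) (rat_pair f)"
proof -
  obtain u v w x y z where ef: "e = (u, v, w)" "f = (x, y, z)" by (metis prod_cases3)
  have "w \<noteq> 0" "z \<noteq> 0" using assms ef by simp_all
  hence "inc (rat_pair e) (rat_pair f) \<longleftrightarrow> real_of_int (v * z + w * y) = real_of_int (u * x)"
    by (simp add: ef inc_def field_simps)
  thus ?thesis by (simp only: ef rat_test.simps of_int_eq_iff)
qed

text \<open>The pair \<open>(a, b)\<close> of integers stands for \<open>a + b * sqrt d\<close>.\<close>

type_synonym quad = "int \<times> int"

text \<open>This is the cleared incidence equation over Q(sqrt d), split into two: the first
  conjunct compares the coefficients of \<open>sqrt d\<close>, the second the rational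
  parts.\<close>

fun quad_test :: "int \<Rightarrow> quad \<times> quad \<times> quad \<Rightarrow> quad \<times> quad \<times> quad \<Rightarrow> bool" where
  "quad_test d ((u, u'), (v, v'), (w, w')) ((x, x'), (y, y'), (z, z')) \<longleftrightarrow>
     v * z' + v' * z + w * y' + w' * y = u * x' + u' * x \<and>
     v * z + w * y + d * (v' * z' + w' * y') = u * x + d * (u' * x')"

fun quad_proper :: "quad \<times> quad \<times> quad \<Rightarrow> bool" where
  "quad_proper (u, v, (w, w')) \<longleftrightarrow> w \<noteq> 0 \<or> w' \<noteq> 0"

definition quad_real :: "int \<Rightarrow> quad \<Rightarrow> real" where
  "quad_real d x = of_int (fst x) + of_int (snd x) * sqrt (of_int d)"

fun quad_pair :: "int \<Rightarrow> quad \<times> quad \<times> quad \<Rightarrow> pair" where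
  "quad_pair d (u, v, w) = (quad_real d u / quad_real d w, quad_real d v / quad_real d w)"

lemma quad_real_eq_0_iff:
  assumes "sqrt (of_int d) \<notin> \<rat>"
  shows "quad_real d x = 0 \<longleftrightarrow> x = (0, 0)"
proof
  assume 0: "quad_real d x = 0"
  have "snd x = 0"
  proof (rule ccontr)
    assume "snd x \<noteq> 0"
    hence "sqrt (of_int d) = - of_int (fst x) / of_int (snd x)"
      using 0 by (simp add: quad_real_def field_simps)
    thus False using assms by simp
  qed
  thus "x = (0, 0)" using 0 by (simp add: quad_real_def prod_eq_iff)
qed (simp add: quad_real_def)

text \<open>Irrationality of \<open>sqrt d\<close> enters twice: it makes the denominators nonzero
  as reals, and it makes a single real equation equivalent to the two integer equations of the
  test.\<close>

lemma quad_test_iff_inc: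
  assumes d: "sqrt (of_int d) \<notin> \<rat>" "d \<ge> 0" and "quad_proper e" "quad_proper f"
  shows "quad_test d e f \<longleftrightarrow> inc (quad_pair d e) (quad_pair d f)"
proof -
  obtain u v w x y z where ef: "e = (u, v, w)" "f = (x, y, z)" by (metis prod_cases3)
  have nz: "quad_real d w \<noteq> 0" "quad_real d z \<noteq> 0"
    using assms ef quad_real_eq_0_iff[OF d(1)] by (cases w; cases z; force)+
  have "inc (quad_pair d e) (quad_pair d f) \<longleftrightarrow>
      quad_real d v * quad_real d z + quad_real d w * quad_real d y - quad_real d u * quad_real d x = 0"
    using nz by (simp add: ef inc_def field_simps)
  also have "quad_real d v * quad_real d z + quad_real d w * quad_real d y - quad_real d u * quad_real d x =
      quad_real d (fst v * fst z + fst w * fst y + d * (snd v * snd z + snd w * snd y) -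
          (fst u * fst x + d * (snd u * snd x)),
        fst v * snd z + snd v * fst z + fst w * snd y + snd w * fst y - (fst u * snd x + snd u * fst x))"
  proof -
    define s where "s = sqrt (of_int d)"
    have "of_int d = s * s" using d(2) by (simp add: s_def)
    thus ?thesis by (simp add: quad_real_def s_def[symmetric] algebra_simps)
  qed
  finally show ?thesis
    unfolding quad_real_eq_0_iff[OF d(1)] ef
    by (cases u; cases v; cases w; cases x; cases y; cases z) auto
qed

subsection \<open>Sizes of configurations\<close>

definition sizes :: "nat set" where
  "sizes = {n. \<exists>A B. slope_configuration n 6 A B}"

lemma interval_plus_interval:
  assumes "{a..b} \<subseteq> sizes" "{c..d} \<subseteq> sizes" "a \<le> b" "c \<le> d"
  shows "{a + c..b + d} \<subseteq> sizes"
proof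
  fix n assume n: "n \<in> {a + c..b + d}"
  have "\<exists>x\<in>{a..b}. \<exists>y\<in>{c..d}. n = x + y"
  proof (cases "n \<le> b + c")
    case True
    hence "n - c \<in> {a..b}" "c \<in> {c..d}" "n = n - c + c" using n assms(3,4) by auto
    thus ?thesis by blast
  next
    case False
    hence "b \<in> {a..b}" "n - b \<in> {c..d}" "n = b + (n - b)" using n assms(3,4) by auto
    thus ?thesis by blast
  qed
  then obtain x y where "n = x + y" "x \<in> sizes" "y \<in> sizes" using assms(1,2) by blast
  thus "n \<in> sizes" using slope_configuration_union unfolding sizes_def by blast
qed

lemma interval_join:
  assumes "{a..b} \<subseteq> sizes" "{c..d} \<subseteq> sizes" "c \<le> Suc b"
  shows "{a..d} \<subseteq> sizes"
proof
  fix n assume "n \<in> {a..d}"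
  hence "n \<in> {a..b} \<or> n \<in> {c..d}" using assms(3) by auto
  thus "n \<in> sizes" using assms(1,2) by blast
qed

text \<open>One step of the covering argument: unions of two systems continue a range already
  covered, provided that the smallest sum leaves no gap.\<close>

lemma interval_extend:
  assumes "{a..b} \<subseteq> sizes" "{c..d} \<subseteq> sizes" "{e..f} \<subseteq> sizes"
    and "c \<le> d" "e \<le> f" "c + e \<le> Suc b"
  shows "{a..d + f} \<subseteq> sizes"
  using interval_join[OF assms(1) interval_plus_interval[OF assms(2,3,4,5)] assms(6)] .

text \<open>Stage \<open>j\<close> is the system after \<open>j\<close> steps and has size
  \<open>b - j\<close>. An entry that is never removed therefore carries the index
  \<open>Suc b - a\<close>, the number of stages. A step that removes a single element lowers the
  size by one only if that element has degree 5.\<close>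

definition stages :: "nat \<Rightarrow> nat \<Rightarrow> (int \<times> nat) list" where
  "stages a b = map (\<lambda>j. (int j, b - j)) [0..<Suc b - a]"

lemma interval_if_check:
  assumes "\<And>e f. proper e \<Longrightarrow> proper f \<Longrightarrow> t e f \<longleftrightarrow> inc (pt e) (pt f)"
    and "check t proper (stages a b) pss lss"
  shows "{a..b} \<subseteq> sizes"
proof
  fix n assume "n \<in> {a..b}"
  hence "b - n \<in> {0..<Suc b - a}" "(int (b - n), n) = (int (b - n), b - (b - n))" by auto
  hence "(int (b - n), n) \<in> set (stages a b)"
    unfolding stages_def set_map set_upt by (rule rev_image_eqI)
  thus "n \<in> sizes"
    unfolding sizes_def using check_imp_slope_configuration[of proper t pt, OF assms] by blast
qed

lemma interval_if_rat_check:
  assumes "check rat_test rat_proper (stages a b) pss lss"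
  shows "{a..b} \<subseteq> sizes"
  using interval_if_check[of rat_proper rat_test rat_pair, OF rat_test_iff_inc assms] .

lemma sqrt_prime_irrational:
  assumes "prime (p::nat)"
  shows "sqrt (real p) \<notin> \<rat>"
proof
  assume "sqrt (real p) \<in> \<rat>"
  then obtain m n :: nat where mn: "n \<noteq> 0" "\<bar>sqrt (real p)\<bar> = real m / real n" "coprime m n"
    by (rule Rats_abs_nat_div_natE)
  hence "real m = sqrt (real p) * real n" by (simp add: field_simps)
  hence "real (m\<^sup>2) = real (p * n\<^sup>2)" by (simp add: power_mult_distrib)
  hence eq: "m\<^sup>2 = p * n\<^sup>2" by (simp only: of_nat_eq_iff)
  hence "p dvd m" using assms prime_dvd_power by (metis dvd_triv_left)
  then obtain k where "m = p * k" ..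
  hence "n\<^sup>2 = p * k\<^sup>2" using eq assms by (auto simp: power2_eq_square algebra_simps prime_gt_0_nat)
  hence "p dvd n" using assms prime_dvd_power by (metis dvd_triv_left)
  with \<open>p dvd m\<close> mn(3) have "p dvd 1" by (meson coprime_common_divisor)
  thus False using assms by simp
qed

lemma interval_if_quad_check:
  assumes "prime d" "check (quad_test (int d)) quad_proper (stages a b) pss lss"
  shows "{a..b} \<subseteq> sizes"
proof (rule interval_if_check[OF quad_test_iff_inc assms(2)])
  show "sqrt (of_int (int d)) \<notin> \<rat>" using sqrt_prime_irrational[OF assms(1)] by simp
qed simp

lemma interval_if_quad_3_check:
  "check (quad_test 3) quad_proper (stages a b) pss lss \<Longrightarrow> {a..b} \<subseteq> sizes"
  using interval_if_quad_check[of 3] by simp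

lemma interval_if_quad_5_check:
  "check (quad_test 5) quad_proper (stages a b) pss lss \<Longrightarrow> {a..b} \<subseteq> sizes"
  using interval_if_quad_check[of 5] by simp


subsection \<open>Sixteen near configurations\<close>

lemma config_282: "{282..282} \<subseteq> sizes"
proof -
  have "check (quad_test 3) quad_proper (stages 282 282)
   [[(1, 0, (-2, -1), (-1, 0), (0, -1)), (1, 1, (-2, 0), (-2, 0), (3, -1)), (1, 2, (-2, 1), (-1, 0), (1, 0)), (1, 3, (2, -1), (-1, 0), (1, 0)), (1, 4, (2, 0), (-2, 0), (3, -1)), (1, 5, (-2, -1), (1, 0), (0, 1)), (1, 6, (-2, -1), (-1, 0), (4, 1)), (1, 7, (2, 0), (2, 0), (-5, -1))],
    [(1, 8, (-2, 1), (-1, 0), (3, 0)), (1, 9, (2, -1), (-1, 0), (3, 0)), (1, 10, (-2, 0), (2, 0), (-5, -1)), (1, 11, (-2, -1), (1, 0), (-4, -1)), (1, 12, (-2, 0), (0, 0), (-1, 0)), (1, 13, (0, -1), (-1, 0), (1, 0)), (1, 14, (-1, 0), (0, -1), (-1, 2)), (1, 15, (0, 0), (-2, 0), (3, 0))],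
    [(1, 16, (1, 0), (0, -1), (-1, 2)), (1, 17, (0, -1), (1, 0), (-1, 0)), (1, 18, (-2, 0), (0, 0), (1, 0)), (1, 19, (0, -1), (-1, 0), (3, 0)), (1, 20, (-1, 0), (0, -1), (1, 2)), (1, 21, (0, 0), (-2, 0), (5, 0)), (1, 22, (1, 0), (0, -1), (1, 2)), (1, 23, (0, -1), (1, 0), (-3, 0))],
    [(1, 24, (-2, -1), (-1, 0), (1, 0)), (1, 25, (-2, 0), (-2, 0), (5, -1)), (1, 26, (-2, 1), (-1, 0), (0, 1)), (1, 27, (2, -1), (-1, 0), (0, 1)), (1, 28, (2, 0), (-2, 0), (5, -1)), (1, 29, (-2, -1), (1, 0), (-1, 0)), (1, 30, (-2, -1), (-1, 0), (3, 0)), (1, 31, (-2, 0), (-2, 0), (3, 1))],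
    [(1, 32, (-2, 1), (-1, 0), (4, -1)), (1, 33, (2, -1), (-1, 0), (4, -1)), (1, 34, (2, 0), (-2, 0), (3, 1)), (1, 35, (-2, -1), (1, 0), (-3, 0)), (1, 36, (-2, -1), (-1, 0), (2, 0)), (1, 37, (-1, 0), (-1, 0), (2, 0)), (1, 38, (-2, 1), (-1, 0), (2, 0)), (1, 39, (2, -1), (-1, 0), (2, 0))],
    [(1, 40, (1, 0), (-1, 0), (2, 0)), (1, 41, (-2, -1), (1, 0), (-2, 0)), (1, 42, (0, 0), (0, 0), (-1, 0))]]
   [[(1, 0, (-2, -1), (-2, 0), (-3, 0)), (1, 1, (-2, -1), (-1, -1), (0, -1)), (1, 2, (-1, 0), (-2, 0), (-2, 1)), (1, 3, (1, 0), (-2, 0), (-2, 1)), (1, 4, (2, 1), (-1, -1), (0, -1)), (1, 5, (-2, -1), (2, 0), (3, 0)), (1, 6, (-2, -1), (2, 0), (5, 0)), (1, 7, (-1, 0), (-1, 1), (-1, 2))],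
    [(1, 8, (-1, 0), (2, 0), (6, 1)), (1, 9, (1, 0), (2, 0), (6, 1)), (1, 10, (1, 0), (-1, 1), (-1, 2)), (1, 11, (-2, -1), (-2, 0), (-5, 0)), (1, 12, (-1, 0), (-1, 0), (-2, 0)), (1, 13, (0, 1), (2, 0), (3, 0)), (1, 14, (1, 0), (2, 0), (4, -1)), (1, 15, (0, 0), (-1, 0), (-1, 0))],
    [(1, 16, (-1, 0), (2, 0), (4, -1)), (1, 17, (0, -1), (2, 0), (3, 0)), (1, 18, (-1, 0), (1, 0), (2, 0)), (1, 19, (0, -1), (2, 0), (5, 0)), (1, 20, (-1, 0), (2, 0), (4, 1)), (1, 21, (0, 0), (1, 0), (3, 0)), (1, 22, (1, 0), (2, 0), (4, 1)), (1, 23, (0, 1), (2, 0), (5, 0))],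
    [(1, 24, (1, 0), (2, 0), (2, 1)), (1, 25, (1, 0), (1, 1), (1, 2)), (1, 26, (2, -1), (2, 0), (3, 0)), (1, 27, (-2, 1), (2, 0), (3, 0)), (1, 28, (-1, 0), (1, 1), (1, 2)), (1, 29, (-1, 0), (2, 0), (2, 1)), (1, 30, (-1, 0), (2, 0), (6, -1)), (1, 31, (-2, 1), (-1, 1), (0, 1))],
    [(1, 32, (-2, 1), (2, 0), (5, 0)), (1, 33, (2, -1), (2, 0), (5, 0)), (1, 34, (2, -1), (-1, 1), (0, 1)), (1, 35, (1, 0), (2, 0), (6, -1)), (1, 36, (-1, 0), (0, 0), (2, -1)), (1, 37, (-1, 0), (0, 0), (1, 0)), (1, 38, (-2, 1), (0, 0), (1, 0)), (1, 39, (2, -1), (0, 0), (1, 0))],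
    [(1, 40, (1, 0), (0, 0), (1, 0)), (1, 41, (-1, 0), (0, 0), (-2, 1)), (1, 42, (0, 0), (1, 0), (2, 0))]]"
    by code_simp
  thus ?thesis by (rule interval_if_quad_3_check)
qed

lemma config_288: "{288..288} \<subseteq> sizes"
proof -
  have "check (quad_test 3) quad_proper (stages 288 288)
   [[(1, 0, (-1, 0), (-1, -1), (-1, -2)), (1, 1, (-1, 0), (-2, 0), (-6, 1)), (1, 2, (-2, 1), (-2, 0), (-5, 0)), (1, 3, (2, -1), (1, -1), (0, -1)), (1, 4, (1, 0), (-2, 0), (-2, -1)), (1, 5, (2, -1), (-2, 0), (-3, 0)), (1, 6, (0, 0), (-1, 0), (-1, 0)), (1, 7, (-1, 0), (-2, 0), (-4, 1))],
    [(1, 8, (0, -1), (-2, 0), (-3, 0)), (1, 9, (-1, 0), (-1, 0), (-2, 0)), (1, 10, (0, -1), (-2, 0), (-5, 0)), (1, 11, (-1, 0), (-2, 0), (-4, -1)), (1, 12, (0, 0), (1, 0), (3, 0)), (1, 13, (1, 0), (-2, 0), (-4, -1)), (1, 14, (0, 1), (-2, 0), (-5, 0)), (1, 15, (-1, 0), (1, 0), (2, 0))],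
    [(1, 16, (0, 1), (-2, 0), (-3, 0)), (1, 17, (1, 0), (-2, 0), (-4, 1)), (1, 18, (-1, 0), (-2, 0), (-2, 1)), (1, 19, (-2, -1), (-1, -1), (0, -1)), (1, 20, (-2, -1), (-2, 0), (-3, 0)), (1, 21, (-2, -1), (-2, 0), (-5, 0)), (1, 22, (-1, 0), (1, -1), (1, -2)), (1, 23, (1, 0), (2, 0), (6, 1))],
    [(1, 24, (-1, 0), (2, 0), (6, 1)), (1, 25, (-1, 0), (-1, 1), (-1, 2)), (1, 26, (-2, -1), (2, 0), (5, 0)), (1, 27, (-2, -1), (2, 0), (3, 0)), (1, 28, (-2, -1), (1, 1), (0, 1)), (1, 29, (1, 0), (-2, 0), (-2, 1)), (1, 30, (2, 1), (2, 0), (1, -2)), (1, 31, (-2, -1), (-1, 0), (-2, 0))],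
    [(1, 32, (2, 1), (2, 0), (7, 2)), (1, 33, (2, 1), (-2, 0), (-7, -2)), (1, 34, (-2, -1), (1, 0), (2, 0)), (1, 35, (2, 1), (-2, 0), (-1, 2)), (1, 36, (0, 0), (0, 0), (1, 0)), (1, 37, (-2, 1), (0, 0), (1, 0)), (1, 38, (0, -1), (0, 0), (1, 0)), (1, 39, (-1, 0), (0, 0), (2, -1))],
    [(1, 40, (0, -1), (0, 0), (-1, 0)), (1, 41, (-1, 0), (0, 0), (-1, 0)), (1, 42, (0, 0), (-1, 0), (-2, 0))]]
   [[(1, 0, (2, 0), (2, 0), (-5, 1)), (1, 1, (2, 1), (-1, 0), (3, 0)), (1, 2, (-2, 1), (1, 0), (-4, 1)), (1, 3, (2, 0), (2, 0), (-3, -1)), (1, 4, (2, 1), (-1, 0), (1, 0)), (1, 5, (-2, 1), (1, 0), (0, -1)), (1, 6, (0, 0), (2, 0), (-3, 0)), (1, 7, (1, 0), (0, 1), (1, -2))],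
    [(1, 8, (0, 1), (1, 0), (-1, 0)), (1, 9, (2, 0), (0, 0), (1, 0)), (1, 10, (0, 1), (-1, 0), (3, 0)), (1, 11, (-1, 0), (0, 1), (-1, -2)), (1, 12, (0, 0), (2, 0), (-5, 0)), (1, 13, (1, 0), (0, 1), (-1, -2)), (1, 14, (0, 1), (1, 0), (-3, 0)), (1, 15, (2, 0), (0, 0), (-1, 0))],
    [(1, 16, (0, 1), (-1, 0), (1, 0)), (1, 17, (-1, 0), (0, 1), (1, -2)), (1, 18, (2, -1), (1, 0), (-1, 0)), (1, 19, (-2, 0), (-2, 0), (3, -1)), (1, 20, (2, 1), (1, 0), (0, 1)), (1, 21, (2, 1), (-1, 0), (4, 1)), (1, 22, (-2, 0), (2, 0), (-5, -1)), (1, 23, (-2, 1), (1, 0), (-3, 0))],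
    [(1, 24, (2, -1), (1, 0), (-3, 0)), (1, 25, (2, 0), (2, 0), (-5, -1)), (1, 26, (2, 1), (1, 0), (-4, -1)), (1, 27, (2, 1), (-1, 0), (0, -1)), (1, 28, (2, 0), (-2, 0), (3, -1)), (1, 29, (2, -1), (-1, 0), (1, 0)), (1, 30, (-1, 0), (0, -1), (-2, 1)), (1, 31, (-2, 0), (0, 0), (-2, -1))],
    [(1, 32, (-1, 0), (0, 1), (-2, -3)), (1, 33, (1, 0), (0, 1), (-2, -3)), (1, 34, (2, 0), (0, 0), (-2, -1)), (1, 35, (1, 0), (0, -1), (-2, 1)), (1, 36, (0, 0), (1, 0), (-2, 0)), (1, 37, (2, -1), (1, 0), (-2, 0)), (1, 38, (0, 1), (1, 0), (-2, 0)), (1, 39, (2, 1), (1, 0), (-2, 0))],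
    [(1, 40, (0, 1), (-1, 0), (2, 0)), (1, 41, (1, 0), (-1, 0), (2, 0)), (1, 42, (0, 0), (0, 0), (-1, 0))]]"
    by code_simp
  thus ?thesis by (rule interval_if_quad_3_check)
qed

lemma config_296: "{296..296} \<subseteq> sizes"
proof -
  have "check (quad_test 3) quad_proper (stages 296 296)
   [[(1, 0, (-1, 0), (-1, 0), (4, 2)), (1, 1, (-2, 1), (-1, 0), (7, -1)), (1, 2, (1, 0), (-1, 0), (2, 2)), (1, 3, (1, 0), (-2, 1), (5, -1)), (1, 4, (1, 0), (1, 0), (0, 2)), (1, 5, (2, -1), (1, 0), (1, 1)), (1, 6, (-1, 0), (1, 0), (2, 2)), (1, 7, (-1, 0), (2, -1), (3, 1))],
    [(1, 8, (-1, 0), (0, 0), (3, 0)), (1, 9, (0, -1), (-1, 0), (5, 1)), (1, 10, (0, 0), (-1, 0), (3, 0)), (1, 11, (1, 0), (0, -1), (3, 1)), (1, 12, (-1, 0), (0, 0), (-1, 0)), (1, 13, (0, 1), (1, 0), (3, -1)), (1, 14, (0, 0), (-1, 0), (-1, 0)), (1, 15, (-1, 0), (0, 1), (5, -1))],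
    [(1, 16, (-1, 0), (-1, 0), (0, 2)), (1, 17, (-1, 0), (-2, -1), (7, 1)), (1, 18, (1, 0), (-1, 0), (-2, 2)), (1, 19, (-2, -1), (1, 0), (-3, 1)), (1, 20, (-1, 0), (-1, 0), (4, -2)), (1, 21, (-1, 0), (-2, -1), (-1, 1)), (1, 22, (1, 0), (-1, 0), (2, -2)), (1, 23, (-2, -1), (1, 0), (5, 1))],
    [(1, 24, (-1, 0), (0, -1), (3, 3)), (1, 25, (0, 1), (-1, 0), (3, 1)), (1, 26, (1, 0), (0, 1), (1, 1)), (1, 27, (0, -1), (1, 0), (1, 3)), (1, 28, (-1, 0), (-2, 1), (1, 1)), (1, 29, (2, -1), (-1, 0), (-3, 3)), (1, 30, (-2, -1), (-1, 0), (1, -1)), (1, 31, (2, -1), (-1, 0), (1, -1))],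
    [(1, 32, (-1, 0), (0, -1), (-1, 3)), (1, 33, (0, -1), (1, 0), (1, -1)), (1, 34, (-1, 0), (0, -1), (3, -1)), (1, 35, (0, -1), (1, 0), (-3, 3)), (1, 36, (-1, 0), (0, 0), (1, 0)), (1, 37, (-1, -1), (1, -1), (0, 2)), (1, 38, (0, -1), (-1, 0), (1, 1)), (1, 39, (0, 0), (-1, 0), (1, 0))],
    [(1, 40, (2, -1), (-1, 0), (-1, 1)), (1, 41, (1, 0), (0, -1), (-1, 1)), (1, 42, (0, 0), (0, 0), (1, 0))]]
   [[(1, 0, (5, 2), (-1, 0), (-3, 0)), (1, 1, (-1, 0), (-1, 0), (-5, -2)), (1, 2, (3, 2), (1, 0), (-1, 0)), (1, 3, (-3, 0), (1, 0), (-3, -2)), (1, 4, (3, 0), (-1, 0), (-1, -2)), (1, 5, (-1, 2), (1, 0), (3, 0)), (1, 6, (1, 0), (1, 0), (1, -2)), (1, 7, (1, 2), (-1, 0), (1, 0))],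
    [(1, 8, (3, 0), (-1, 0), (-5, 2)), (1, 9, (-3, 2), (-1, 0), (-3, 0)), (1, 10, (1, 0), (1, 0), (-3, 2)), (1, 11, (-5, 2), (1, 0), (-1, 0)), (1, 12, (3, 2), (-1, 0), (-1, 0)), (1, 13, (-4, -1), (1, 0), (2, 1)), (1, 14, (1, 0), (-1, 0), (-3, -2)), (1, 15, (0, -1), (-1, 0), (-4, -1))],
    [(1, 16, (1, 2), (1, 0), (1, 0)), (1, 17, (-2, -1), (-1, 0), (0, 1)), (1, 18, (-1, 0), (1, 0), (-1, -2)), (1, 19, (-1, 0), (2, -1), (-1, 0)), (1, 20, (3, 0), (-1, 0), (-3, 0)), (1, 21, (0, 1), (-1, 0), (-2, -1)), (1, 22, (-1, 0), (-1, 0), (-3, 0)), (1, 23, (0, 1), (1, 0), (0, 1))],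
    [(1, 24, (1, 0), (1, 0), (-1, 0)), (1, 25, (-2, 1), (1, 0), (0, -1)), (1, 26, (-3, 0), (1, 0), (-1, 0)), (1, 27, (2, 1), (-1, 0), (-2, 1)), (1, 28, (1, -2), (1, 0), (1, 0)), (1, 29, (-4, 1), (1, 0), (0, 1)), (1, 30, (-1, 0), (1, 0), (-1, 2)), (1, 31, (-2, 1), (1, 0), (4, -1))],
    [(1, 32, (-3, 2), (1, 0), (1, 0)), (1, 33, (1, 0), (2, 1), (1, 0)), (1, 34, (-1, 0), (1, 0), (3, -2)), (1, 35, (0, -1), (1, 0), (-2, 1)), (1, 36, (1, 0), (0, 0), (-1, 0)), (1, 37, (1, 0), (0, 0), (0, -1)), (1, 38, (2, -1), (0, 0), (-1, 0)), (1, 39, (-1, 0), (0, 0), (-1, 0))],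
    [(1, 40, (0, 1), (0, 0), (1, 0)), (1, 41, (1, 0), (0, 0), (2, -1)), (1, 42, (-1, 0), (1, 0), (1, 0))]]"
    by code_simp
  thus ?thesis by (rule interval_if_quad_3_check)
qed

lemma config_339: "{339..339} \<subseteq> sizes"
proof -
  have "check (quad_test 3) quad_proper (stages 339 339)
   [[(1, 0, (-2, 0), (-1, 0), (2, 0)), (1, 1, (-4, 0), (0, -1), (1, 2)), (1, 2, (-4, 0), (-1, 0), (2, 1)), (1, 3, (-2, 0), (0, 0), (1, 0)), (1, 4, (-4, 0), (1, 0), (-2, 1)), (1, 5, (-4, 0), (0, 1), (1, -2)), (1, 6, (-2, 0), (1, 0), (-2, 0)), (1, 7, (-4, 0), (0, 1), (-1, -2))],
    [(1, 8, (-4, 0), (1, 0), (-2, -1)), (1, 9, (-2, 0), (0, 0), (-1, 0)), (1, 10, (-4, 0), (-1, 0), (2, -1)), (1, 11, (-4, 0), (0, -1), (-1, 2)), (1, 12, (-4, 0), (-2, -1), (5, 2)), (1, 13, (2, -2), (-1, 0), (3, 0)), (1, 14, (-4, 0), (-1, 0), (4, 1)), (1, 15, (-4, 0), (1, 0), (0, 1))],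
    [(1, 16, (2, -2), (1, 0), (-1, 0)), (1, 17, (-8, 4), (1, 0), (0, -1)), (1, 18, (-4, 0), (2, 1), (-5, -2)), (1, 19, (2, -2), (1, 0), (-3, 0)), (1, 20, (-4, 0), (1, 0), (-4, -1)), (1, 21, (-4, 0), (-1, 0), (0, -1)), (1, 22, (2, -2), (-1, 0), (1, 0)), (1, 23, (-8, 4), (-1, 0), (0, 1))],
    [(1, 24, (-2, 0), (-1, 0), (3, 0)), (1, 25, (-2, -2), (1, 0), (0, 1)), (1, 26, (2, -2), (1, 0), (0, -1)), (1, 27, (-2, 0), (1, 0), (-3, 0)), (1, 28, (-2, -2), (-1, 0), (0, -1)), (1, 29, (2, -2), (-1, 0), (0, 1)), (1, 30, (1, -1), (-1, 0), (2, 0)), (1, 31, (2, -2), (0, -1), (1, 2))],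
    [(1, 32, (2, -2), (-1, 0), (2, 1)), (1, 33, (1, -1), (0, 0), (1, 0)), (1, 34, (2, -2), (1, 0), (-2, 1)), (1, 35, (-2, 2), (0, -1), (-1, 2)), (1, 36, (-1, 1), (-1, 0), (2, 0)), (1, 37, (-2, 2), (0, -1), (1, 2)), (1, 38, (-2, 2), (-1, 0), (2, 1)), (1, 39, (-1, 1), (0, 0), (1, 0))],
    [(1, 40, (-2, 2), (1, 0), (-2, 1)), (1, 41, (2, -2), (0, -1), (-1, 2)), (1, 42, (0, 0), (-1, 0), (2, 0)), (1, 43, (0, 0), (0, -1), (1, 2)), (1, 44, (0, 0), (-1, 0), (3, 0)), (1, 45, (0, 0), (-1, 0), (2, 1)), (1, 46, (0, 0), (0, 0), (1, 0)), (1, 47, (0, 0), (1, 0), (0, 1))],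
    [(1, 48, (0, 0), (1, 0), (-2, 1)), (1, 49, (0, 0), (0, -1), (-1, 2)), (1, 50, (0, 0), (-1, 0), (0, 1))]]
   [[(1, 0, (-1, 0), (0, 0), (-4, 0)), (1, 1, (-1, 0), (2, 0), (4, -2)), (1, 2, (-1, 0), (0, 2), (-2, 4)), (1, 3, (-1, 0), (4, 0), (8, 0)), (1, 4, (-1, 0), (0, 2), (2, 4)), (1, 5, (1, 0), (-2, 0), (-4, -2)), (1, 6, (1, 0), (0, 0), (-4, 0)), (1, 7, (1, 0), (2, 0), (4, -2))],
    [(1, 8, (1, 0), (0, 2), (-2, 4)), (1, 9, (1, 0), (4, 0), (8, 0)), (1, 10, (1, 0), (0, 2), (2, 4)), (1, 11, (-1, 0), (-2, 0), (-4, -2)), (1, 12, (-2, -1), (2, 0), (0, -2)), (1, 13, (-1, 0), (2, 0), (0, 2)), (1, 14, (-1, 0), (-2, 2), (-6, 6)), (1, 15, (2, 1), (2, 0), (0, -2))],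
    [(1, 16, (1, 0), (2, 0), (0, 2)), (1, 17, (1, 0), (-2, 2), (-6, 6)), (1, 18, (-1, -1), (2, 0), (0, -2)), (1, 19, (-1, 0), (2, 0), (2, 0)), (1, 20, (1, -1), (2, 0), (0, 2)), (1, 21, (-1, 0), (1, 1), (1, 3)), (1, 22, (-1, 0), (2, 0), (6, 0)), (1, 23, (1, 0), (1, -1), (1, -3))],
    [(1, 24, (1, 1), (2, 0), (0, -2)), (1, 25, (1, 0), (2, 0), (2, 0)), (1, 26, (-1, 1), (2, 0), (0, 2)), (1, 27, (1, 0), (1, 1), (1, 3)), (1, 28, (1, 0), (2, 0), (6, 0)), (1, 29, (-1, 0), (1, -1), (1, -3)), (1, 30, (-1, 0), (0, 0), (2, -2)), (1, 31, (-1, -1), (2, 0), (4, -2))],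
    [(1, 32, (-1, -1), (0, 2), (-2, 4)), (1, 33, (-1, -1), (4, 0), (8, 0)), (1, 34, (-1, -1), (0, 2), (2, 4)), (1, 35, (-1, 0), (-1, 1), (1, 1)), (1, 36, (1, 0), (0, 0), (2, -2)), (1, 37, (1, 1), (2, 0), (4, -2)), (1, 38, (1, 1), (0, 2), (-2, 4)), (1, 39, (1, 1), (4, 0), (8, 0))],
    [(1, 40, (1, 1), (0, 2), (2, 4)), (1, 41, (-1, 0), (1, -1), (-1, -1)), (1, 42, (0, 0), (0, 0), (-1, 0)), (1, 43, (0, 0), (1, 0), (0, -1)), (1, 44, (0, 0), (1, 0), (2, -1)), (1, 45, (0, 0), (0, 1), (-1, 2)), (1, 46, (0, 0), (1, 0), (0, 1)), (1, 47, (0, 0), (1, 0), (2, 0))],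
    [(1, 48, (0, 0), (0, 1), (1, 2)), (1, 49, (0, 0), (1, 0), (3, 0)), (1, 50, (0, 0), (-1, 0), (-2, -1))]]"
    by code_simp
  thus ?thesis by (rule interval_if_quad_3_check)
qed

lemma configs_340_344: "{340..344} \<subseteq> sizes"
proof -
  have "check (quad_test 3) quad_proper (stages 340 344)
   [[(5, 0, (-1, -1), (-2, 0), (4, 0)), (5, 1, (-1, -1), (0, -1), (1, 2)), (5, 2, (-1, 0), (0, 0), (-1, 1)), (5, 3, (-1, -1), (1, 0), (-2, 1)), (5, 4, (-1, -1), (2, 0), (-4, 0)), (5, 5, (-1, -1), (0, 1), (-1, -2)), (5, 6, (-1, 0), (0, 0), (1, -1)), (5, 7, (-1, -1), (-1, 0), (2, -1))],
    [(5, 8, (1, -1), (-1, 0), (4, -1)), (5, 9, (-1, 0), (-1, 0), (3, 0)), (5, 10, (-1, -1), (-1, 0), (4, 1)), (5, 11, (-1, -1), (1, 0), (0, 1)), (5, 12, (-1, 0), (1, 0), (-1, 0)), (5, 13, (-1, 1), (-1, 0), (0, 1)), (5, 14, (-1, 1), (-1, 0), (4, -1)), (5, 15, (1, 0), (-1, 0), (3, 0))],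
    [(5, 16, (1, 1), (-1, 0), (4, 1)), (5, 17, (1, 1), (1, 0), (0, 1)), (5, 18, (1, 0), (1, 0), (-1, 0)), (5, 19, (1, -1), (-1, 0), (0, 1)), (5, 20, (1, -1), (-2, 0), (4, 0)), (5, 21, (1, -1), (0, -1), (1, 2)), (5, 22, (-1, 0), (0, 0), (1, 1)), (5, 23, (1, -1), (1, 0), (-2, 1))],
    [(5, 24, (-1, 1), (-2, 0), (4, 0)), (5, 25, (-1, 1), (0, -1), (1, 2)), (5, 26, (1, 0), (0, 0), (1, 1)), (5, 27, (-1, 1), (1, 0), (-2, 1)), (5, 28, (-1, 0), (-1, 0), (4, -1)), (5, 29, (-2, -1), (1, 0), (0, 1)), (5, 30, (1, 0), (-1, 0), (4, -1)), (5, 31, (2, 1), (1, 0), (0, 1))],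
    [(5, 32, (-1, 0), (-2, 0), (4, 0)), (5, 33, (-1, 0), (0, -1), (1, 2)), (5, 34, (-1, 0), (0, 0), (2, 0)), (5, 35, (-1, 0), (1, 0), (-2, 1)), (5, 36, (1, 0), (-2, 0), (4, 0)), (5, 37, (1, 0), (0, -1), (1, 2)), (5, 38, (1, 0), (0, 0), (2, 0)), (5, 39, (1, 0), (1, 0), (-2, 1))],
    [(5, 40, (-2, 1), (-1, 0), (4, -1)), (5, 41, (-1, 0), (1, 0), (0, 1)), (2, 42, (2, -1), (-1, 0), (4, -1)), (3, 43, (1, 0), (1, 0), (0, 1)), (5, 44, (0, 0), (-1, 0), (3, 0)), (5, 45, (0, 0), (-1, 0), (2, 1)), (5, 46, (0, 0), (-1, 0), (4, 1)), (5, 47, (0, 0), (1, 0), (-1, 0))],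
    [(5, 48, (0, 0), (0, -1), (-1, 2)), (5, 49, (0, 0), (-1, 0), (0, 1)), (5, 50, (1, 0), (0, -1), (-1, 2)), (5, 51, (-1, 0), (0, -1), (-1, 2)), (5, 52, (1, 0), (-1, 0), (2, 1)), (5, 53, (-1, 0), (-1, 0), (2, 1))]]
   [[(5, 0, (1, -1), (0, 1), (-1, 2)), (5, 1, (-1, 1), (-1, 0), (-2, -1)), (5, 2, (-1, 1), (0, 1), (-1, 2)), (5, 3, (1, -1), (-1, 0), (-2, -1)), (5, 4, (-1, 0), (1, 0), (1, 0)), (5, 5, (1, -1), (1, 0), (0, 1)), (5, 6, (-1, 0), (1, 0), (3, 0)), (5, 7, (1, 1), (-1, 0), (-4, -1))],
    [(5, 8, (1, 0), (1, 0), (1, 0)), (5, 9, (-1, 1), (1, 0), (0, 1)), (5, 10, (1, 0), (1, 0), (3, 0)), (5, 11, (-1, -1), (-1, 0), (-4, -1)), (4, 12, (1, 1), (0, -1), (1, -2)), (5, 13, (2, 0), (1, -1), (-1, -1)), (5, 14, (1, 1), (0, 1), (-1, 2)), (1, 15, (2, 0), (-1, 1), (1, 1))],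
    [(5, 16, (1, -1), (1, 0), (1, 0)), (5, 17, (-4, 2), (1, 0), (0, 1)), (5, 18, (1, -1), (1, 0), (3, 0)), (5, 19, (2, 0), (-1, 0), (-4, -1)), (5, 20, (-1, 1), (1, 0), (1, 0)), (5, 21, (4, -2), (1, 0), (0, 1)), (5, 22, (-1, 1), (1, 0), (3, 0)), (5, 23, (-2, 0), (-1, 0), (-4, -1))],
    [(5, 24, (-1, 0), (0, 0), (-1, 0)), (5, 25, (2, 0), (-1, 0), (-2, 1)), (5, 26, (2, 0), (0, -1), (1, -2)), (5, 27, (-1, 0), (1, 0), (2, 0)), (5, 28, (2, 0), (0, -1), (-1, -2)), (5, 29, (2, 0), (-1, 0), (-2, -1)), (5, 30, (1, 0), (0, 0), (-1, 0)), (5, 31, (2, 0), (1, 0), (2, -1))],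
    [(5, 32, (2, 0), (0, 1), (-1, 2)), (5, 33, (1, 0), (1, 0), (2, 0)), (5, 34, (2, 0), (0, 1), (1, 2)), (5, 35, (2, 0), (1, 0), (2, 1)), (5, 36, (1, 1), (-1, 0), (-1, 0)), (5, 37, (2, 0), (-1, 0), (0, -1)), (5, 38, (1, 1), (-1, 0), (-3, 0)), (5, 39, (2, 0), (-2, 1), (-5, 2))],
    [(5, 40, (1, 1), (1, 0), (1, 0)), (5, 41, (2, 0), (1, 0), (0, 1)), (5, 42, (1, 1), (1, 0), (3, 0)), (5, 43, (2, 0), (2, -1), (5, -2)), (5, 44, (0, 0), (0, 0), (-1, 0)), (5, 45, (0, 0), (1, 0), (0, -1)), (5, 46, (0, 0), (1, 0), (2, -1)), (5, 47, (0, 0), (1, 0), (2, 0))],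
    [(5, 48, (0, 0), (1, 0), (4, -1)), (5, 49, (0, 0), (0, 1), (1, 2)), (5, 50, (-1, -1), (1, 0), (0, -1)), (5, 51, (1, -1), (1, 0), (4, -1)), (5, 52, (1, 1), (1, 0), (0, -1)), (5, 53, (-1, 1), (1, 0), (4, -1))]]"
    by code_simp
  thus ?thesis by (rule interval_if_quad_3_check)
qed

text \<open>The only system over Q(sqrt 5). Each index from 1 to 10 occurs once among the points and
  lines together, so one element of degree 5 leaves at every step.\<close>

lemma configs_350_360: "{350..360} \<subseteq> sizes"
proof -
  have "check (quad_test 5) quad_proper (stages 350 360)
   [[(11, 0, (-1, 0), (0, 0), (2, 0)), (11, 1, (-1, -1), (0, -1), (3, 0)), (11, 2, (-2, 0), (0, -1), (-1, 0)), (11, 3, (-2, 0), (0, -1), (1, -2)), (11, 4, (1, 1), (0, 1), (3, 2)), (11, 5, (1, 0), (0, 0), (2, 0)), (11, 6, (1, 1), (0, -1), (3, 0)), (11, 7, (2, 0), (0, -1), (-1, 0))],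
    [(11, 8, (2, 0), (0, -1), (1, -2)), (11, 9, (-1, -1), (0, 1), (3, 2)), (11, 10, (1, -1), (2, -1), (1, 0)), (11, 11, (-2, 0), (-1, 0), (-2, 1)), (11, 12, (-1, -1), (-2, 0), (-2, 0)), (11, 13, (-2, 0), (-1, 0), (0, -1)), (11, 14, (-3, -1), (-1, 0), (-4, -1)), (11, 15, (-1, 1), (2, -1), (1, 0))],
    [(11, 16, (-2, 0), (1, 0), (2, -1)), (11, 17, (-1, -1), (2, 0), (2, 0)), (11, 18, (-2, 0), (1, 0), (0, 1)), (11, 19, (-3, -1), (1, 0), (4, 1)), (11, 20, (-1, 0), (0, 0), (-1, 1)), (11, 21, (-3, -1), (0, -1), (3, 0)), (11, 22, (-1, -1), (0, -1), (-1, 0)), (11, 23, (-1, -1), (0, -1), (1, -2))],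
    [(11, 24, (-3, -1), (0, -1), (-3, -2)), (11, 25, (1, 0), (0, 0), (-1, 1)), (11, 26, (3, 1), (0, -1), (3, 0)), (11, 27, (-1, -1), (0, 1), (1, 0)), (11, 28, (-1, -1), (0, 1), (-1, 2)), (11, 29, (-3, -1), (0, 1), (3, 2)), (11, 30, (-1, 1), (5, -2), (0, -1)), (11, 31, (2, 0), (0, 1), (-5, 2))],
    [(11, 32, (-1, -1), (0, -2), (0, -2)), (11, 33, (2, 0), (0, 1), (5, 0)), (11, 34, (3, 1), (0, 1), (5, 4)), (11, 35, (-1, 1), (-5, 2), (0, 1)), (11, 36, (2, 0), (0, -1), (5, -2)), (11, 37, (1, 1), (0, -2), (0, -2)), (11, 38, (2, 0), (0, -1), (-5, 0)), (11, 39, (3, 1), (0, -1), (-5, -4))],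
    [(11, 40, (0, 0), (0, 0), (1, 0)), (11, 41, (0, 0), (2, -1), (1, 0)), (11, 42, (0, 0), (0, -1), (3, 0)), (11, 43, (0, 0), (-1, 0), (-2, 1)), (11, 44, (0, 0), (0, -1), (-1, 0)), (11, 45, (0, 0), (-1, 0), (-1, 0)), (11, 46, (0, 0), (0, -1), (1, -2)), (11, 47, (0, 0), (1, 0), (0, 1))],
    [(11, 48, (0, 0), (0, 1), (3, 2)), (11, 49, (0, 0), (1, 0), (4, 1)), (2, 50, (-2, 0), (0, 1), (3, 2)), (9, 51, (-1, 0), (0, 0), (1, 1)), (4, 52, (-2, 0), (0, -1), (3, 0)), (3, 53, (-3, -1), (0, -1), (-1, 0)), (5, 54, (-3, -1), (0, 1), (-1, 2))]]
   [[(11, 0, (1, 0), (-1, 0), (1, 0)), (11, 1, (-1, 1), (-1, 0), (0, 1)), (11, 2, (1, 1), (-1, 0), (4, 1)), (11, 3, (1, 1), (1, 0), (2, 1)), (11, 4, (-1, 1), (1, 0), (-2, 1)), (11, 5, (-1, 0), (-1, 0), (1, 0)), (11, 6, (1, -1), (-1, 0), (0, 1)), (11, 7, (-1, -1), (-1, 0), (4, 1))],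
    [(11, 8, (-1, -1), (1, 0), (2, 1)), (11, 9, (1, -1), (1, 0), (-2, 1)), (11, 10, (0, -2), (0, 1), (1, -2)), (11, 11, (-5, -1), (0, 1), (-3, -2)), (11, 12, (0, -1), (0, 0), (-2, 0)), (11, 13, (5, 1), (0, 1), (3, 0)), (11, 14, (0, -2), (0, -1), (1, 0)), (11, 15, (0, -2), (0, -1), (-1, 2))],
    [(11, 16, (5, 1), (0, 1), (-3, -2)), (11, 17, (0, -1), (0, 0), (2, 0)), (11, 18, (-5, -1), (0, 1), (3, 0)), (11, 19, (0, -2), (0, 1), (-1, 0)), (11, 20, (-1, 1), (-2, 0), (2, 0)), (11, 21, (3, -1), (-1, 0), (0, 1)), (11, 22, (2, 0), (-1, 0), (4, 1)), (11, 23, (2, 0), (1, 0), (2, 1))],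
    [(11, 24, (1, 1), (2, 1), (1, 0)), (11, 25, (1, -1), (-2, 0), (2, 0)), (11, 26, (-3, 1), (-1, 0), (0, 1)), (11, 27, (-2, 0), (-1, 0), (4, 1)), (11, 28, (-2, 0), (1, 0), (2, 1)), (11, 29, (-1, -1), (2, 1), (1, 0)), (11, 30, (-5, 3), (0, -1), (-1, 2)), (11, 31, (5, -1), (0, -1), (3, 2))],
    [(11, 32, (0, 1), (0, 0), (3, 1)), (11, 33, (5, -1), (0, 1), (3, 0)), (11, 34, (5, -3), (0, -1), (1, 0)), (11, 35, (5, -3), (0, -1), (-1, 2)), (11, 36, (-5, 1), (0, -1), (3, 2)), (11, 37, (0, -1), (0, 0), (3, 1)), (11, 38, (-5, 1), (0, 1), (3, 0)), (11, 39, (-5, 3), (0, -1), (1, 0))],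
    [(11, 40, (0, 0), (-1, 0), (1, 0)), (11, 41, (0, 0), (0, -1), (-1, 2)), (11, 42, (0, 0), (-1, 0), (0, 1)), (11, 43, (0, 0), (0, -1), (3, 2)), (11, 44, (0, 0), (-1, 0), (4, 1)), (11, 45, (0, 0), (0, 0), (1, 0)), (11, 46, (0, 0), (-2, 1), (1, 0)), (11, 47, (0, 0), (0, 1), (3, 0))],
    [(11, 48, (0, 0), (1, 0), (-2, 1)), (11, 49, (0, 0), (0, -1), (1, 0)), (8, 50, (0, 1), (0, 0), (1, 1)), (1, 51, (-5, 1), (0, -1), (1, 0)), (7, 52, (0, -2), (0, 1), (3, 0)), (6, 53, (0, -2), (0, -1), (3, 2)), (10, 54, (-5, 1), (0, 1), (1, -2))]]"
    by code_simp
  thus ?thesis by (rule interval_if_quad_5_check)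
qed

lemma configs_374_378: "{374..378} \<subseteq> sizes"
proof -
  have "check (quad_test 3) quad_proper (stages 374 378)
   [[(5, 0, (-1, -1), (-1, 0), (3, 0)), (5, 1, (-2, 0), (-2, 1), (5, -2)), (5, 2, (-1, -1), (1, 0), (-1, 0)), (5, 3, (-2, 0), (1, 0), (0, -1)), (5, 4, (-1, -1), (1, 0), (-3, 0)), (5, 5, (-2, 0), (2, -1), (-5, 2)), (5, 6, (-1, -1), (-1, 0), (1, 0)), (5, 7, (-2, 0), (-1, 0), (0, 1))],
    [(5, 8, (-1, 0), (-1, 0), (2, 0)), (5, 9, (-2, 0), (0, -1), (1, 2)), (5, 10, (-1, 0), (0, 0), (1, 0)), (5, 11, (-2, 0), (1, 0), (-2, 1)), (5, 12, (1, 0), (-1, 0), (2, 0)), (5, 13, (-2, 0), (0, 1), (-1, -2)), (5, 14, (1, 0), (0, 0), (1, 0)), (5, 15, (-2, 0), (-1, 0), (2, -1))],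
    [(5, 16, (-4, 2), (-1, 0), (4, -1)), (5, 17, (1, -1), (-1, 0), (3, 0)), (5, 18, (-2, 0), (-1, 0), (4, 1)), (5, 19, (-2, 0), (1, 0), (0, 1)), (5, 20, (1, -1), (1, 0), (-1, 0)), (5, 21, (4, -2), (-1, 0), (0, 1)), (5, 22, (4, -2), (-1, 0), (4, -1)), (5, 23, (-1, 1), (-1, 0), (3, 0))],
    [(5, 24, (2, 0), (-1, 0), (4, 1)), (5, 25, (2, 0), (1, 0), (0, 1)), (5, 26, (-1, 1), (1, 0), (-1, 0)), (5, 27, (-4, 2), (-1, 0), (0, 1)), (5, 28, (-2, 0), (0, -1), (-3, 4)), (5, 29, (-4, -2), (0, 1), (3, 0)), (5, 30, (-2, 0), (0, 1), (3, -4)), (5, 31, (-4, -2), (0, -1), (-3, 0))],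
    [(5, 32, (-1, 0), (0, -1), (0, 2)), (5, 33, (-2, 0), (-3, 0), (6, 1)), (5, 34, (-2, 0), (0, -1), (3, 2)), (5, 35, (-1, 0), (0, 0), (0, 1)), (5, 36, (-2, 0), (0, 1), (3, -2)), (5, 37, (2, 0), (-3, 0), (6, -1)), (5, 38, (1, 0), (0, -1), (0, 2)), (5, 39, (2, 0), (-3, 0), (6, 1))],
    [(5, 40, (2, 0), (0, -1), (3, 2)), (5, 41, (1, 0), (0, 0), (0, 1)), (5, 42, (2, 0), (0, 1), (3, -2)), (5, 43, (-2, 0), (-3, 0), (6, -1)), (5, 44, (0, 0), (-1, 0), (2, 0)), (5, 45, (0, 0), (-1, 0), (4, -1)), (5, 46, (0, 0), (0, -1), (1, 2)), (5, 47, (0, 0), (-1, 0), (3, 0))],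
    [(5, 48, (0, 0), (-1, 0), (4, 1)), (5, 49, (0, 0), (0, 0), (1, 0)), (5, 50, (0, 0), (1, 0), (0, 1)), (5, 51, (0, 0), (1, 0), (-2, 1)), (5, 52, (0, 0), (1, 0), (-1, 0)), (5, 53, (0, 0), (-1, 0), (0, 1)), (1, 54, (-2, 0), (-1, 0), (4, -1)), (2, 55, (2, 0), (0, 1), (3, 0))]]
   [[(5, 0, (-1, 0), (1, 0), (0, -1)), (5, 1, (-2, 1), (1, 0), (4, -1)), (5, 2, (1, 0), (1, 0), (0, -1)), (5, 3, (2, -1), (1, 0), (4, -1)), (5, 4, (-1, 0), (0, 0), (-2, 0)), (5, 5, (-1, 0), (1, 0), (2, -1)), (5, 6, (-1, 0), (0, 1), (-1, 2)), (5, 7, (-1, 0), (2, 0), (4, 0))],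
    [(5, 8, (-1, 0), (0, 1), (1, 2)), (5, 9, (1, 0), (-1, 0), (-2, -1)), (5, 10, (1, 0), (0, 0), (-2, 0)), (5, 11, (1, 0), (1, 0), (2, -1)), (5, 12, (1, 0), (0, 1), (-1, 2)), (5, 13, (1, 0), (2, 0), (4, 0)), (5, 14, (1, 0), (0, 1), (1, 2)), (5, 15, (-1, 0), (-1, 0), (-2, -1))],
    [(5, 16, (-3, 1), (2, 0), (2, 0)), (5, 17, (3, -2), (1, 0), (0, 1)), (5, 18, (-3, 1), (2, 0), (6, 0)), (5, 19, (0, 1), (-1, 0), (-4, -1)), (5, 20, (3, -1), (2, 0), (2, 0)), (5, 21, (-3, 2), (1, 0), (0, 1)), (5, 22, (3, -1), (2, 0), (6, 0)), (5, 23, (0, -1), (-1, 0), (-4, -1))],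
    [(5, 24, (0, -1), (0, 0), (-2, 0)), (5, 25, (0, -1), (1, 0), (2, -1)), (5, 26, (0, -1), (2, 0), (4, 0)), (5, 27, (0, -1), (0, 1), (1, 2)), (5, 28, (0, 1), (0, 0), (-2, 0)), (5, 29, (0, 1), (1, 0), (2, -1)), (5, 30, (0, 1), (2, 0), (4, 0)), (5, 31, (0, 1), (0, 1), (1, 2))],
    [(5, 32, (3, 2), (-1, 0), (0, 1)), (5, 33, (-3, -1), (2, 0), (2, 0)), (5, 34, (0, 1), (-1, 0), (0, -1)), (5, 35, (0, 1), (-1, 0), (-4, 1)), (5, 36, (-3, -1), (2, 0), (6, 0)), (5, 37, (0, 1), (-2, 1), (-5, 2)), (5, 38, (-3, -2), (-1, 0), (0, 1)), (5, 39, (3, 1), (2, 0), (2, 0))],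
    [(5, 40, (0, 1), (1, 0), (0, 1)), (5, 41, (0, 1), (1, 0), (4, -1)), (5, 42, (3, 1), (2, 0), (6, 0)), (5, 43, (0, 1), (2, -1), (5, -2)), (5, 44, (0, 0), (0, 0), (-1, 0)), (5, 45, (0, 0), (1, 0), (0, -1)), (5, 46, (0, 0), (1, 0), (2, -1)), (5, 47, (0, 0), (1, 0), (1, 0))],
    [(5, 48, (0, 0), (1, 0), (0, 1)), (5, 49, (0, 0), (1, 0), (2, 0)), (5, 50, (0, 0), (1, 0), (4, -1)), (5, 51, (0, 0), (0, 1), (1, 2)), (5, 52, (0, 0), (1, 0), (3, 0)), (5, 53, (0, 0), (-1, 0), (-4, -1)), (3, 54, (0, -1), (1, 0), (0, -1)), (4, 55, (1, 0), (1, 0), (4, -1))]]"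
    by code_simp
  thus ?thesis by (rule interval_if_quad_3_check)
qed

lemma configs_378_386: "{378..386} \<subseteq> sizes"
proof -
  have "check (quad_test 3) quad_proper (stages 378 386)
   [[(9, 0, (-1, 0), (-1, 0), (2, 0)), (9, 1, (-2, 0), (0, -1), (-1, 2)), (9, 2, (-2, 0), (-1, 0), (2, -1)), (9, 3, (-1, 0), (0, 0), (-1, 0)), (9, 4, (-2, 0), (1, 0), (-2, -1)), (9, 5, (-2, 0), (0, 1), (-1, -2)), (9, 6, (1, 0), (-1, 0), (2, 0)), (9, 7, (-2, 0), (0, 1), (1, -2))],
    [(9, 8, (-2, 0), (1, 0), (-2, 1)), (9, 9, (1, 0), (0, 0), (-1, 0)), (9, 10, (-2, 0), (-1, 0), (2, 1)), (9, 11, (-2, 0), (0, -1), (1, 2)), (9, 12, (-4, 2), (-1, 0), (0, 1)), (9, 13, (1, -1), (-1, 0), (1, 0)), (9, 14, (-2, 0), (-1, 0), (0, -1)), (9, 15, (-2, 0), (1, 0), (-4, -1))],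
    [(9, 16, (1, -1), (1, 0), (-3, 0)), (9, 17, (4, -2), (-1, 0), (4, -1)), (9, 18, (4, -2), (-1, 0), (0, 1)), (9, 19, (-1, 1), (-1, 0), (1, 0)), (9, 20, (2, 0), (-1, 0), (0, -1)), (9, 21, (2, 0), (1, 0), (-4, -1)), (9, 22, (-1, 1), (1, 0), (-3, 0)), (9, 23, (-4, 2), (-1, 0), (4, -1))],
    [(9, 24, (-2, 1), (-1, 0), (2, 0)), (9, 25, (2, 0), (2, 1), (-1, 0)), (9, 26, (-4, 2), (1, 0), (-2, -1)), (9, 27, (2, -1), (-1, 0), (2, 0)), (9, 28, (2, 0), (-2, -1), (1, 0)), (9, 29, (4, -2), (1, 0), (-2, -1)), (9, 30, (-1, -1), (0, -1), (-1, 2)), (9, 31, (-1, 0), (0, 0), (1, -1))],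
    [(9, 32, (-1, -1), (0, 1), (-1, -2)), (9, 33, (-1, -1), (0, 1), (1, -2)), (9, 34, (-1, 0), (0, 0), (-1, 1)), (9, 35, (-1, -1), (0, -1), (1, 2)), (9, 36, (1, -1), (-1, 0), (0, 1)), (9, 37, (-1, 0), (-1, 0), (1, 0)), (9, 38, (-1, -1), (-1, 0), (0, -1)), (9, 39, (-1, -1), (1, 0), (-4, -1))],
    [(9, 40, (-1, 0), (1, 0), (-3, 0)), (9, 41, (-1, 1), (-1, 0), (4, -1)), (9, 42, (-1, 1), (-1, 0), (0, 1)), (9, 43, (1, 0), (-1, 0), (1, 0)), (9, 44, (1, 1), (-1, 0), (0, -1)), (9, 45, (1, 1), (1, 0), (-4, -1)), (9, 46, (1, 0), (1, 0), (-3, 0)), (9, 47, (1, -1), (-1, 0), (4, -1))],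
    [(9, 48, (0, 0), (-1, 0), (2, 0)), (9, 49, (0, 0), (0, -1), (-1, 2)), (9, 50, (0, 0), (-1, 0), (2, -1)), (9, 51, (0, 0), (0, 0), (-1, 0)), (9, 52, (0, 0), (1, 0), (-2, -1)), (9, 53, (0, 0), (0, -1), (1, 2)), (2, 54, (-1, 1), (1, 0), (-2, -1)), (3, 55, (1, -1), (0, -1), (1, 2))],
    [(7, 56, (1, -1), (-2, 0), (4, 0)), (4, 57, (1, 0), (0, 0), (-1, -1))]]
   [[(9, 0, (2, 1), (1, 0), (4, 1)), (9, 1, (-1, -1), (-2, 0), (-6, 0)), (9, 2, (1, 0), (1, 0), (4, -1)), (9, 3, (1, 0), (1, 0), (0, 1)), (9, 4, (-1, -1), (-2, 0), (-2, 0)), (9, 5, (-2, -1), (-1, 0), (0, 1)), (9, 6, (-2, -1), (1, 0), (4, 1)), (9, 7, (-1, -1), (2, 0), (6, 0))],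
    [(9, 8, (-1, 0), (1, 0), (4, -1)), (9, 9, (-1, 0), (1, 0), (0, 1)), (9, 10, (-1, -1), (2, 0), (2, 0)), (9, 11, (-2, -1), (1, 0), (0, -1)), (9, 12, (-2, -1), (0, 0), (-2, 0)), (9, 13, (-2, -1), (0, -1), (-1, -2)), (9, 14, (-2, -1), (0, -1), (1, -2)), (9, 15, (-2, -1), (0, 0), (2, 0))],
    [(9, 16, (-2, -1), (0, 1), (1, 2)), (9, 17, (-2, -1), (0, 1), (-1, 2)), (9, 18, (-1, 1), (1, 0), (2, 1)), (9, 19, (-1, 1), (2, 0), (4, 0)), (9, 20, (1, -1), (-1, 0), (-2, 1)), (9, 21, (1, -1), (1, 0), (2, 1)), (9, 22, (1, -1), (2, 0), (4, 0)), (9, 23, (-1, 1), (-1, 0), (-2, 1))],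
    [(9, 24, (1, 1), (1, 0), (4, 1)), (9, 25, (1, 0), (1, 0), (3, 0)), (9, 26, (-1, 1), (1, 0), (4, -1)), (9, 27, (-1, 1), (1, 0), (0, 1)), (9, 28, (1, 0), (1, 0), (1, 0)), (9, 29, (-1, -1), (-1, 0), (0, 1)), (9, 30, (-1, -1), (1, 0), (4, 1)), (9, 31, (-1, 0), (1, 0), (3, 0))],
    [(9, 32, (1, -1), (1, 0), (4, -1)), (9, 33, (1, -1), (1, 0), (0, 1)), (9, 34, (-1, 0), (1, 0), (1, 0)), (9, 35, (1, 1), (-1, 0), (0, 1)), (9, 36, (-1, 0), (0, 0), (1, -1)), (9, 37, (-2, 0), (1, -1), (-1, -1)), (9, 38, (-1, -1), (0, -1), (-1, -2)), (9, 39, (-1, -1), (-2, 0), (-4, 0))],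
    [(9, 40, (-1, -1), (0, -1), (1, -2)), (9, 41, (-1, -1), (-1, 0), (-2, 1)), (9, 42, (-1, 0), (0, 0), (-1, 1)), (9, 43, (-2, 0), (-1, 1), (1, 1)), (9, 44, (-1, -1), (0, 1), (1, 2)), (9, 45, (-1, -1), (2, 0), (4, 0)), (9, 46, (-1, -1), (0, 1), (-1, 2)), (9, 47, (-1, -1), (1, 0), (2, -1))],
    [(9, 48, (0, 0), (0, 0), (1, 0)), (9, 49, (0, 0), (1, 0), (2, 1)), (9, 50, (0, 0), (0, 1), (1, 2)), (9, 51, (0, 0), (1, 0), (2, 0)), (9, 52, (0, 0), (0, 1), (-1, 2)), (9, 53, (0, 0), (-1, 0), (-2, 1)), (5, 54, (-1, 0), (0, 1), (-1, 2)), (6, 55, (1, 0), (-1, 0), (-2, 1))],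
    [(8, 56, (1, 0), (0, 0), (2, 0)), (1, 57, (1, 0), (1, 0), (2, 1))]]"
    by code_simp
  thus ?thesis by (rule interval_if_quad_3_check)
qed

lemma configs_390_392: "{390..392} \<subseteq> sizes"
proof -
  have "check (quad_test 3) quad_proper (stages 390 392)
   [[(3, 0, (-1, 0), (0, 0), (1, 0)), (3, 1, (-2, 0), (-1, 0), (-2, 1)), (3, 2, (-2, 0), (0, -1), (1, -2)), (3, 3, (-1, 0), (-1, 0), (-2, 0)), (3, 4, (-2, 0), (0, -1), (-1, -2)), (3, 5, (-2, 0), (-1, 0), (-2, -1)), (3, 6, (1, 0), (0, 0), (1, 0)), (3, 7, (-2, 0), (1, 0), (2, -1))],
    [(3, 8, (-2, 0), (0, 1), (-1, 2)), (3, 9, (1, 0), (-1, 0), (-2, 0)), (3, 10, (-2, 0), (0, 1), (1, 2)), (3, 11, (-2, 0), (1, 0), (2, 1)), (3, 12, (-2, 0), (-1, 0), (0, 1)), (3, 13, (1, -1), (-1, 0), (-1, 0)), (3, 14, (-4, 2), (-1, 0), (0, -1)), (3, 15, (-4, 2), (-1, 0), (-4, 1))],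
    [(3, 16, (1, -1), (-1, 0), (-3, 0)), (3, 17, (2, 0), (1, 0), (4, 1)), (3, 18, (2, 0), (-1, 0), (0, 1)), (3, 19, (-1, 1), (-1, 0), (-1, 0)), (3, 20, (4, -2), (-1, 0), (0, -1)), (3, 21, (4, -2), (-1, 0), (-4, 1)), (3, 22, (-1, 1), (-1, 0), (-3, 0)), (3, 23, (-2, 0), (1, 0), (4, 1))],
    [(3, 24, (2, 0), (2, 1), (1, 0)), (3, 25, (-4, 2), (0, -1), (1, -2)), (3, 26, (-2, 1), (-1, 0), (-2, 0)), (3, 27, (4, -2), (1, 0), (2, 1)), (3, 28, (2, -1), (0, 0), (1, 0)), (3, 29, (2, 0), (-2, -1), (-1, 0)), (3, 30, (2, -1), (-1, 0), (-2, 0)), (3, 31, (4, -2), (0, -1), (-1, -2))],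
    [(3, 32, (-4, 2), (1, 0), (2, 1)), (3, 33, (-1, 0), (0, 0), (-1, 1)), (3, 34, (-1, -1), (0, -1), (1, -2)), (3, 35, (-1, -1), (0, -1), (-1, -2)), (3, 36, (-1, 0), (0, 0), (1, -1)), (3, 37, (-1, -1), (0, 1), (-1, 2)), (3, 38, (-1, -1), (0, 1), (1, 2)), (3, 39, (-1, -1), (-1, 0), (0, 1))],
    [(3, 40, (-1, 0), (-1, 0), (-1, 0)), (3, 41, (1, -1), (-1, 0), (0, -1)), (3, 42, (1, -1), (-1, 0), (-4, 1)), (3, 43, (-1, 0), (-1, 0), (-3, 0)), (3, 44, (1, 1), (1, 0), (4, 1)), (3, 45, (1, 1), (-1, 0), (0, 1)), (3, 46, (1, 0), (-1, 0), (-1, 0)), (3, 47, (-1, 1), (-1, 0), (0, -1))],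
    [(3, 48, (-1, 1), (-1, 0), (-4, 1)), (3, 49, (1, 0), (-1, 0), (-3, 0)), (3, 50, (-1, -1), (1, 0), (4, 1)), (3, 51, (0, 0), (0, 0), (1, 0)), (3, 52, (0, 0), (-1, 0), (-2, 1)), (3, 53, (0, 0), (0, -1), (1, -2)), (3, 54, (0, 0), (-1, 0), (-2, 0)), (3, 55, (0, 0), (0, -1), (-1, -2))],
    [(3, 56, (0, 0), (1, 0), (2, 1)), (1, 57, (-1, 1), (1, 0), (2, 1)), (2, 58, (-1, 1), (-1, 0), (-2, 1))]]
   [[(3, 0, (1, 0), (-1, 0), (4, -1)), (3, 1, (-1, -1), (2, 0), (-6, 0)), (3, 2, (2, 1), (-1, 0), (4, 1)), (3, 3, (2, 1), (1, 0), (0, 1)), (3, 4, (-1, -1), (-2, 0), (2, 0)), (3, 5, (-1, 0), (-1, 0), (0, 1)), (3, 6, (-1, 0), (-1, 0), (4, -1)), (3, 7, (-1, -1), (-2, 0), (6, 0))],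
    [(3, 8, (-2, -1), (-1, 0), (4, 1)), (3, 9, (-2, -1), (1, 0), (0, 1)), (3, 10, (-1, -1), (2, 0), (-2, 0)), (3, 11, (-1, 0), (1, 0), (0, -1)), (3, 12, (-2, -1), (2, 0), (-4, 0)), (3, 13, (-2, -1), (0, 1), (-1, -2)), (3, 14, (-2, -1), (0, 0), (-2, 0)), (3, 15, (-2, -1), (-1, 0), (2, -1))],
    [(3, 16, (-2, -1), (0, -1), (-1, 2)), (3, 17, (-2, -1), (0, -1), (1, 2)), (3, 18, (-1, 0), (-2, 1), (1, 0)), (3, 19, (-2, -1), (0, 0), (2, 0)), (3, 20, (-2, -1), (0, 1), (1, -2)), (3, 21, (-1, 1), (-2, 0), (4, 0)), (3, 22, (-1, 1), (-1, 0), (2, 1)), (3, 23, (-1, 1), (1, 0), (-2, 1))],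
    [(3, 24, (1, -1), (-2, 0), (4, 0)), (3, 25, (1, -1), (-1, 0), (2, 1)), (3, 26, (1, -1), (1, 0), (-2, 1)), (3, 27, (-1, 1), (-1, 0), (4, -1)), (3, 28, (1, 0), (-1, 0), (3, 0)), (3, 29, (1, 1), (-1, 0), (4, 1)), (3, 30, (1, 1), (1, 0), (0, 1)), (3, 31, (1, 0), (1, 0), (-1, 0))],
    [(3, 32, (1, -1), (-1, 0), (0, 1)), (3, 33, (1, -1), (-1, 0), (4, -1)), (3, 34, (-1, 0), (-1, 0), (3, 0)), (3, 35, (-1, -1), (-1, 0), (4, 1)), (3, 36, (-1, -1), (1, 0), (0, 1)), (3, 37, (-1, 0), (1, 0), (-1, 0)), (3, 38, (-1, 1), (-1, 0), (0, 1)), (3, 39, (-1, -1), (2, 0), (-4, 0))],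
    [(3, 40, (-1, -1), (0, 1), (-1, -2)), (3, 41, (-2, 0), (-1, 1), (-1, -1)), (3, 42, (-1, 0), (0, 0), (1, -1)), (3, 43, (-1, -1), (-1, 0), (2, -1)), (3, 44, (-1, -1), (0, -1), (-1, 2)), (3, 45, (-1, -1), (-2, 0), (4, 0)), (3, 46, (-1, -1), (0, -1), (1, 2)), (3, 47, (-2, 0), (1, -1), (1, 1))],
    [(3, 48, (-1, 0), (0, 0), (-1, 1)), (3, 49, (-1, -1), (1, 0), (-2, 1)), (3, 50, (-1, -1), (0, 1), (1, -2)), (3, 51, (0, 0), (-1, 0), (2, 0)), (3, 52, (0, 0), (0, -1), (1, 2)), (3, 53, (0, 0), (-1, 0), (2, 1)), (3, 54, (0, 0), (0, 0), (1, 0)), (3, 55, (0, 0), (1, 0), (-2, 1))],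
    [(3, 56, (0, 0), (0, -1), (-1, 2))]]"
    by code_simp
  thus ?thesis by (rule interval_if_quad_3_check)
qed

lemma configs_424_433: "{424..433} \<subseteq> sizes"
proof -
  have "check (quad_test 3) quad_proper (stages 424 433)
   [[(10, 0, (-1, -1), (-1, 0), (2, 0)), (10, 1, (-2, -2), (0, -1), (1, 2)), (10, 2, (-4, 0), (1, -1), (1, 1)), (10, 3, (-1, -1), (0, 0), (1, 0)), (10, 4, (-2, -2), (1, 0), (-2, 1)), (10, 5, (-2, -2), (0, 1), (1, -2)), (10, 6, (-1, -1), (1, 0), (-2, 0)), (10, 7, (-2, -2), (0, 1), (-1, -2))],
    [(10, 8, (-4, 0), (-1, 1), (-1, -1)), (10, 9, (-1, -1), (0, 0), (-1, 0)), (10, 10, (-2, -2), (-1, 0), (2, -1)), (10, 11, (-2, -2), (0, -1), (-1, 2)), (10, 12, (-4, 0), (-1, -1), (1, 3)), (10, 13, (-2, 0), (-1, 0), (3, 0)), (10, 14, (-4, 0), (1, -1), (-1, 3)), (10, 15, (-2, -2), (1, 0), (0, 1))],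
    [(10, 16, (-2, 0), (1, 0), (-1, 0)), (10, 17, (2, -2), (1, 0), (0, -1)), (10, 18, (-4, 0), (1, 1), (-1, -3)), (10, 19, (-2, 0), (1, 0), (-3, 0)), (10, 20, (-4, 0), (-1, 1), (1, -3)), (10, 21, (-2, -2), (-1, 0), (0, -1)), (10, 22, (-2, 0), (-1, 0), (1, 0)), (10, 23, (2, -2), (-1, 0), (0, 1))],
    [(10, 24, (2, -2), (0, -1), (-3, 4)), (10, 25, (-2, 0), (0, -1), (0, 3)), (10, 26, (2, 2), (0, 1), (-3, -4)), (10, 27, (2, 2), (0, -1), (-3, 0)), (10, 28, (-2, 0), (0, 1), (0, -1)), (10, 29, (-2, 2), (0, -1), (3, 0)), (10, 30, (-2, 2), (0, -1), (-3, 4)), (10, 31, (-2, 0), (0, 1), (0, -3))],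
    [(10, 32, (2, 2), (0, -1), (3, 4)), (10, 33, (2, 2), (0, 1), (3, 0)), (10, 34, (-2, 0), (0, -1), (0, 1)), (10, 35, (2, -2), (0, -1), (3, 0)), (10, 36, (-1, 0), (-1, 0), (2, 0)), (10, 37, (-2, 0), (0, -1), (1, 2)), (10, 38, (-2, 0), (-1, 0), (2, 1)), (10, 39, (-1, 0), (0, 0), (1, 0))],
    [(10, 40, (-2, 0), (1, 0), (-2, 1)), (10, 41, (-2, 0), (0, 1), (1, -2)), (10, 42, (1, 0), (-1, 0), (2, 0)), (10, 43, (-2, 0), (0, 1), (-1, -2)), (10, 44, (-2, 0), (1, 0), (-2, -1)), (10, 45, (1, 0), (0, 0), (1, 0)), (10, 46, (-2, 0), (-1, 0), (2, -1)), (10, 47, (-2, 0), (0, -1), (-1, 2))],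
    [(10, 48, (0, 0), (-1, 0), (2, 0)), (10, 49, (0, 0), (-1, 0), (4, -1)), (10, 50, (0, 0), (0, -1), (1, 2)), (10, 51, (0, 0), (-1, 0), (3, 0)), (10, 52, (0, 0), (-1, 0), (2, 1)), (10, 53, (0, 0), (-1, 0), (4, 1)), (10, 54, (0, 0), (0, 0), (1, 0)), (10, 55, (0, 0), (1, 0), (0, 1))],
    [(10, 56, (0, 0), (1, 0), (-2, 1)), (10, 57, (0, 0), (1, 0), (-1, 0)), (10, 58, (0, 0), (0, -1), (-1, 2)), (10, 59, (0, 0), (-1, 0), (0, 1)), (4, 60, (-4, -2), (1, 0), (0, 1)), (3, 61, (-2, 0), (1, 0), (0, -1)), (8, 62, (-1, -1), (-1, 0), (1, 0)), (7, 63, (-2, 0), (-1, 0), (4, -1))]]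
   [[(10, 0, (-1, -1), (2, 0), (0, -2)), (10, 1, (-1, 0), (2, 0), (2, 0)), (10, 2, (1, -1), (2, 0), (0, 2)), (10, 3, (-1, 0), (1, 1), (1, 3)), (10, 4, (-1, 0), (2, 0), (6, 0)), (10, 5, (1, 0), (1, -1), (1, -3)), (10, 6, (1, 1), (2, 0), (0, -2)), (10, 7, (1, 0), (2, 0), (2, 0))],
    [(10, 8, (-1, 1), (2, 0), (0, 2)), (10, 9, (1, 0), (1, 1), (1, 3)), (10, 10, (1, 0), (2, 0), (6, 0)), (10, 11, (-1, 0), (1, -1), (1, -3)), (10, 12, (0, -1), (0, 0), (-2, -2)), (10, 13, (0, -1), (1, 1), (-1, 1)), (9, 14, (0, -1), (3, 1), (5, 1)), (10, 15, (-3, 1), (4, 0), (8, 0))],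
    [(10, 16, (-3, 1), (0, 2), (2, 4)), (1, 17, (0, -1), (1, 1), (5, 3)), (10, 18, (0, 1), (0, 0), (-2, -2)), (10, 19, (0, -1), (-1, -1), (1, -1)), (10, 20, (0, -1), (-3, -1), (-5, -1)), (10, 21, (3, -1), (4, 0), (8, 0)), (10, 22, (3, -1), (0, 2), (2, 4)), (10, 23, (0, -1), (-1, -1), (-5, -3))],
    [(10, 24, (-1, 0), (1, 0), (0, -1)), (10, 25, (1, -1), (2, 0), (2, 0)), (10, 26, (-2, 1), (1, 0), (0, 1)), (5, 27, (-2, 1), (1, 0), (4, -1)), (10, 28, (1, -1), (2, 0), (6, 0)), (10, 29, (1, 0), (-1, 0), (-4, -1)), (10, 30, (1, 0), (1, 0), (0, -1)), (10, 31, (-1, 1), (2, 0), (2, 0))],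
    [(10, 32, (2, -1), (1, 0), (0, 1)), (10, 33, (2, -1), (1, 0), (4, -1)), (10, 34, (-1, 1), (2, 0), (6, 0)), (10, 35, (-1, 0), (-1, 0), (-4, -1)), (10, 36, (-1, 0), (0, 0), (-2, 0)), (10, 37, (-1, 0), (1, 0), (2, -1)), (10, 38, (-1, 0), (0, 1), (-1, 2)), (10, 39, (-1, 0), (2, 0), (4, 0))],
    [(10, 40, (-1, 0), (0, 1), (1, 2)), (10, 41, (1, 0), (-1, 0), (-2, -1)), (10, 42, (1, 0), (0, 0), (-2, 0)), (10, 43, (1, 0), (0, 1), (-1, 2)), (2, 44, (1, 0), (2, 0), (4, 0)), (10, 45, (1, 0), (0, 1), (1, 2)), (10, 46, (-1, 0), (-1, 0), (-2, -1)), (10, 47, (0, -1), (0, 0), (-2, 0))],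
    [(10, 48, (0, -1), (1, 0), (2, -1)), (10, 49, (0, 1), (0, -1), (1, -2)), (10, 50, (0, -1), (2, 0), (4, 0)), (10, 51, (0, -1), (0, 1), (1, 2)), (10, 52, (0, 1), (-1, 0), (-2, -1)), (10, 53, (0, 1), (0, 0), (-2, 0)), (10, 54, (0, 1), (1, 0), (2, -1)), (10, 55, (0, 1), (0, 1), (-1, 2))],
    [(10, 56, (0, 1), (2, 0), (4, 0)), (10, 57, (0, 1), (0, 1), (1, 2)), (10, 58, (0, 1), (1, 0), (2, 1)), (10, 59, (0, 0), (1, 0), (0, -1)), (10, 60, (0, 0), (1, 0), (1, 0)), (10, 61, (0, 0), (1, 0), (0, 1)), (10, 62, (0, 0), (1, 0), (4, -1)), (10, 63, (0, 0), (1, 0), (3, 0))],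
    [(10, 64, (0, 0), (-1, 0), (-4, -1)), (10, 65, (0, -1), (2, 0), (6, 0)), (10, 66, (3, 1), (2, 0), (0, -2)), (6, 67, (0, 1), (2, 0), (2, 0)), (10, 68, (0, 1), (1, 1), (1, 3))]]"
    by code_simp
  thus ?thesis by (rule interval_if_quad_3_check)
qed

lemma configs_452_456: "{452..456} \<subseteq> sizes"
proof -
  have "check (quad_test 3) quad_proper (stages 452 456)
   [[(5, 0, (-1, 0), (-2, 0), (2, 0)), (5, 1, (-1, 0), (-4, 0), (2, 1)), (5, 2, (0, 0), (-2, 0), (1, 0)), (5, 3, (0, 1), (-4, 0), (1, -2)), (5, 4, (1, 0), (-2, 0), (-2, 0)), (5, 5, (1, 0), (-4, 0), (-2, -1)), (5, 6, (0, 0), (-2, 0), (-1, 0)), (5, 7, (0, -1), (-4, 0), (-1, 2))],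
    [(5, 8, (-2, -1), (-4, 0), (5, 2)), (5, 9, (-1, 0), (2, -2), (3, 0)), (5, 10, (1, 0), (-4, 0), (0, 1)), (5, 11, (1, 0), (2, -2), (-1, 0)), (5, 12, (2, 1), (-4, 0), (-5, -2)), (5, 13, (1, 0), (2, -2), (-3, 0)), (5, 14, (-1, 0), (-4, 0), (0, -1)), (5, 15, (-1, 0), (2, -2), (1, 0))],
    [(5, 16, (0, -1), (-2, 0), (0, 2)), (5, 17, (0, -1), (-4, 0), (3, 2)), (5, 18, (0, 0), (-2, 0), (0, 1)), (5, 19, (3, 0), (-4, 0), (-6, 1)), (5, 20, (0, 1), (-2, 0), (0, -2)), (5, 21, (0, 1), (-4, 0), (-3, -2)), (5, 22, (0, 0), (-2, 0), (0, -1)), (5, 23, (-3, 0), (-4, 0), (6, -1))],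
    [(5, 24, (-1, -1), (-4, 0), (1, 3)), (5, 25, (-1, 0), (-2, 0), (3, 0)), (5, 26, (1, 0), (-2, -2), (0, 1)), (5, 27, (1, 0), (-2, 0), (-1, 0)), (5, 28, (1, 1), (-4, 0), (-1, -3)), (5, 29, (1, 0), (-2, 0), (-3, 0)), (5, 30, (-1, 0), (-2, -2), (0, -1)), (5, 31, (-1, 0), (-2, 0), (1, 0))],
    [(5, 32, (-1, 0), (1, -1), (2, 0)), (5, 33, (-1, 0), (2, -2), (2, 1)), (5, 34, (0, 0), (1, -1), (1, 0)), (5, 35, (0, -1), (-2, 2), (-1, 2)), (5, 36, (-1, 0), (-1, 1), (2, 0)), (5, 37, (-1, 0), (-2, 2), (2, 1)), (5, 38, (0, 0), (-1, 1), (1, 0)), (5, 39, (0, -1), (2, -2), (-1, 2))],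
    [(5, 40, (0, -1), (2, -2), (-3, 4)), (5, 41, (0, -1), (-2, 0), (0, 3)), (5, 42, (0, 1), (-2, -2), (3, 0)), (5, 43, (0, 1), (-2, 0), (0, -1)), (5, 44, (0, -1), (-2, 2), (-3, 4)), (5, 45, (0, 1), (-2, 0), (0, -3)), (5, 46, (0, 1), (2, 2), (3, 0)), (5, 47, (0, -1), (-2, 0), (0, 1))],
    [(5, 48, (0, -1), (-2, 0), (1, 2)), (5, 49, (1, 0), (-2, 0), (-2, 1)), (5, 50, (0, 1), (-2, 0), (-1, -2)), (5, 51, (-1, 0), (-2, 0), (2, -1)), (5, 52, (-1, 0), (0, 0), (2, 0)), (5, 53, (-1, 0), (0, 0), (4, -1)), (5, 54, (0, -1), (0, 0), (1, 2)), (5, 55, (-1, 0), (0, 0), (3, 0))],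
    [(5, 56, (-1, 0), (0, 0), (2, 1)), (5, 57, (-1, 0), (0, 0), (4, 1)), (5, 58, (0, 0), (0, 0), (1, 0)), (5, 59, (1, 0), (0, 0), (0, 1)), (5, 60, (1, 0), (0, 0), (-2, 1)), (5, 61, (1, 0), (0, 0), (-1, 0)), (5, 62, (0, -1), (0, 0), (-1, 2)), (5, 63, (-1, 0), (0, 0), (0, 1))],
    [(5, 64, (1, -1), (-4, 0), (-1, 3)), (2, 65, (1, 0), (2, -2), (0, -1)), (5, 66, (-1, 0), (2, -2), (0, 1)), (5, 67, (-1, 1), (-4, 0), (1, -3))]]
   [[(5, 0, (4, -2), (-2, 0), (-1, 0)), (1, 1, (2, 4), (0, -2), (-1, 0)), (3, 2, (4, -2), (-2, 0), (1, 0)), (5, 3, (2, 4), (0, -2), (1, 0)), (5, 4, (0, 2), (-2, 0), (-1, 0)), (5, 5, (-8, -2), (2, 0), (2, 1)), (5, 6, (0, 2), (-2, 0), (1, 0)), (5, 7, (-8, -2), (2, 0), (-2, -1))],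
    [(5, 8, (4, -2), (-2, 0), (0, -1)), (5, 9, (2, 4), (0, -2), (0, -1)), (5, 10, (4, -2), (-2, 0), (0, 1)), (5, 11, (2, 4), (0, -2), (0, 1)), (5, 12, (0, 2), (-2, 0), (0, -1)), (5, 13, (-8, -2), (2, 0), (3, 2)), (5, 14, (0, 2), (-2, 0), (0, 1)), (5, 15, (-8, -2), (2, 0), (-3, -2))],
    [(5, 16, (0, -2), (-2, 0), (-1, -1)), (5, 17, (2, 0), (-2, 0), (-1, 0)), (5, 18, (1, 3), (-1, -1), (-1, 0)), (5, 19, (6, 0), (-2, 0), (-1, 0)), (5, 20, (0, -2), (-2, 0), (1, 1)), (5, 21, (2, 0), (-2, 0), (1, 0)), (5, 22, (1, 3), (-1, -1), (1, 0)), (5, 23, (6, 0), (-2, 0), (1, 0))],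
    [(5, 24, (2, -2), (0, 0), (-1, 0)), (5, 25, (-2, 4), (0, -2), (-1, -1)), (5, 26, (8, 0), (-4, 0), (-1, -1)), (5, 27, (-1, -1), (-1, 1), (1, 0)), (5, 28, (2, -2), (0, 0), (1, 0)), (5, 29, (-2, 4), (0, -2), (1, 1)), (5, 30, (8, 0), (-4, 0), (1, 1)), (5, 31, (-1, -1), (-1, 1), (-1, 0))],
    [(5, 32, (0, -2), (-2, 0), (-3, -1)), (5, 33, (2, 0), (-2, 0), (0, -1)), (5, 34, (0, 2), (-2, 0), (-3, 1)), (5, 35, (1, 3), (-1, -1), (0, -1)), (5, 36, (6, 0), (-2, 0), (0, -1)), (5, 37, (1, -3), (-1, 1), (0, 1)), (5, 38, (0, -2), (-2, 0), (3, 1)), (5, 39, (2, 0), (-2, 0), (0, 1))],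
    [(5, 40, (0, 2), (-2, 0), (3, -1)), (5, 41, (1, 3), (-1, -1), (0, 1)), (5, 42, (6, 0), (-2, 0), (0, 1)), (5, 43, (1, -3), (-1, 1), (0, -1)), (5, 44, (5, -3), (-1, 1), (0, 1)), (5, 45, (-5, 1), (3, -1), (0, 1)), (5, 46, (-5, 3), (1, -1), (0, 1)), (5, 47, (5, -1), (-3, 1), (0, 1))],
    [(5, 48, (-2, 0), (0, 0), (-1, 0)), (5, 49, (-1, 2), (0, -1), (-1, 0)), (2, 50, (4, 0), (-2, 0), (-1, 0)), (5, 51, (-2, -1), (1, 0), (1, 0)), (5, 52, (-2, 0), (0, 0), (1, 0)), (4, 53, (-1, 2), (0, -1), (1, 0)), (5, 54, (4, 0), (-2, 0), (1, 0)), (5, 55, (-2, -1), (1, 0), (-1, 0))],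
    [(5, 56, (0, -1), (-1, 0), (-2, -1)), (5, 57, (-2, 0), (2, 0), (1, 1)), (5, 58, (4, -1), (-1, 0), (-1, 0)), (5, 59, (-6, 0), (2, 0), (1, 1)), (5, 60, (0, -1), (-1, 0), (2, 1)), (5, 61, (2, 0), (-2, 0), (1, 1)), (5, 62, (4, -1), (-1, 0), (1, 0)), (5, 63, (6, 0), (-2, 0), (1, 1))],
    [(5, 64, (-2, 0), (0, 0), (0, -1)), (5, 65, (1, -2), (0, 1), (0, 1)), (5, 66, (4, 0), (-2, 0), (0, -1)), (5, 67, (-2, -1), (1, 0), (0, 1)), (5, 68, (-2, 0), (0, 0), (0, 1)), (5, 69, (-1, 2), (0, -1), (0, 1)), (5, 70, (4, 0), (-2, 0), (0, 1)), (5, 71, (2, 1), (-1, 0), (0, 1))]]"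
    by code_simp
  thus ?thesis by (rule interval_if_quad_3_check)
qed

lemma configs_580_586: "{580..586} \<subseteq> sizes"
proof -
  have "check (quad_test 3) quad_proper (stages 580 586)
   [[(7, 0, (-2, 0), (-1, 0), (2, 0)), (7, 1, (-4, 0), (0, -1), (-1, 2)), (7, 2, (-2, 0), (0, 0), (-1, 0)), (7, 3, (-4, 0), (1, 0), (-2, -1)), (7, 4, (-2, 0), (1, 0), (-2, 0)), (7, 5, (-4, 0), (0, 1), (1, -2)), (7, 6, (-2, 0), (0, 0), (1, 0)), (7, 7, (-4, 0), (-1, 0), (2, 1))],
    [(7, 8, (2, -2), (-1, 0), (1, 0)), (7, 9, (-4, 0), (-1, 0), (0, -1)), (7, 10, (2, -2), (1, 0), (-3, 0)), (7, 11, (-4, 0), (2, 1), (-5, -2)), (7, 12, (2, -2), (1, 0), (-1, 0)), (7, 13, (-4, 0), (1, 0), (0, 1)), (7, 14, (2, -2), (-1, 0), (3, 0)), (7, 15, (-4, 0), (-2, -1), (5, 2))],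
    [(7, 16, (-2, 0), (-1, 0), (1, 0)), (7, 17, (-2, -2), (-1, 0), (0, -1)), (7, 18, (-2, 0), (1, 0), (-3, 0)), (7, 19, (-4, 0), (1, 1), (-1, -3)), (7, 20, (-2, 0), (1, 0), (-1, 0)), (7, 21, (-2, -2), (1, 0), (0, 1)), (7, 22, (-2, 0), (-1, 0), (3, 0)), (7, 23, (-4, 0), (-1, -1), (1, 3))],
    [(7, 24, (1, -1), (-1, 0), (2, 0)), (7, 25, (2, -2), (0, -1), (-1, 2)), (7, 26, (2, -2), (-1, 0), (2, -1)), (7, 27, (1, -1), (0, 0), (-1, 0)), (7, 28, (2, -2), (1, 0), (-2, -1)), (7, 29, (-2, 2), (0, -1), (1, 2)), (7, 30, (-1, 1), (-1, 0), (2, 0)), (7, 31, (-2, 2), (0, -1), (-1, 2))],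
    [(7, 32, (-2, 2), (-1, 0), (2, -1)), (7, 33, (-1, 1), (0, 0), (-1, 0)), (7, 34, (-2, 2), (1, 0), (-2, -1)), (7, 35, (2, -2), (0, -1), (1, 2)), (7, 36, (-2, 0), (-1, 0), (0, 1)), (7, 37, (-2, 0), (2, -1), (-5, 2)), (7, 38, (-2, 0), (1, 0), (0, -1)), (7, 39, (-2, 0), (-2, 1), (5, -2))],
    [(7, 40, (-1, 0), (-1, 0), (2, 0)), (7, 41, (-2, 0), (0, -1), (-1, 2)), (7, 42, (-1, 0), (0, 0), (-1, 0)), (7, 43, (-2, 0), (1, 0), (-2, -1)), (7, 44, (1, 0), (-1, 0), (2, 0)), (7, 45, (-2, 0), (0, 1), (1, -2)), (7, 46, (1, 0), (0, 0), (-1, 0)), (7, 47, (-2, 0), (-1, 0), (2, 1))],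
    [(7, 48, (1, -1), (-1, 0), (1, 0)), (7, 49, (-2, 0), (-1, 0), (0, -1)), (7, 50, (1, -1), (1, 0), (-3, 0)), (7, 51, (4, -2), (-1, 0), (4, -1)), (7, 52, (-1, 1), (-1, 0), (1, 0)), (7, 53, (2, 0), (-1, 0), (0, -1)), (7, 54, (-1, 1), (1, 0), (-3, 0)), (7, 55, (-4, 2), (-1, 0), (4, -1))],
    [(7, 56, (-1, 0), (-1, 0), (1, 0)), (7, 57, (-1, -1), (-1, 0), (0, -1)), (7, 58, (-1, 0), (1, 0), (-3, 0)), (7, 59, (-1, 1), (-1, 0), (4, -1)), (7, 60, (1, 0), (-1, 0), (1, 0)), (7, 61, (1, 1), (-1, 0), (0, -1)), (7, 62, (1, 0), (1, 0), (-3, 0)), (7, 63, (1, -1), (-1, 0), (4, -1))],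
    [(7, 64, (1, -1), (-2, 0), (4, 0)), (7, 65, (1, -1), (0, -1), (-1, 2)), (7, 66, (-1, 0), (0, 0), (-1, -1)), (7, 67, (1, -1), (1, 0), (-2, -1)), (7, 68, (-1, 1), (-2, 0), (4, 0)), (7, 69, (-1, 1), (0, -1), (-1, 2)), (7, 70, (1, 0), (0, 0), (-1, -1)), (7, 71, (-1, 1), (1, 0), (-2, -1))],
    [(7, 72, (-1, 0), (-1, 0), (2, -1)), (7, 73, (1, 0), (0, -1), (1, 2)), (7, 74, (1, 0), (-1, 0), (2, -1)), (7, 75, (-1, 0), (0, -1), (1, 2)), (7, 76, (-2, 1), (-1, 0), (0, 1)), (7, 77, (-1, 0), (1, 0), (-4, -1)), (7, 78, (2, -1), (-1, 0), (0, 1)), (7, 79, (1, 0), (1, 0), (-4, -1))],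
    [(7, 80, (0, 0), (-1, 0), (0, 1)), (7, 81, (0, 0), (-1, 0), (2, -1)), (7, 82, (0, 0), (1, 0), (-4, -1)), (7, 83, (0, 0), (0, -1), (1, 2)), (7, 84, (2, -2), (-1, 0), (0, 1)), (5, 85, (-1, 1), (0, -1), (1, 2)), (6, 86, (-1, 1), (-1, 0), (2, -1))]]
   [[(7, 0, (1, 0), (0, 2), (2, 4)), (7, 1, (-1, 0), (-2, 0), (-4, 2)), (7, 2, (-1, 0), (0, 2), (2, 4)), (7, 3, (1, 0), (-2, 0), (-4, 2)), (7, 4, (2, 1), (2, 0), (8, 2)), (7, 5, (1, 0), (2, 0), (0, 2)), (7, 6, (-2, -1), (2, 0), (8, 2)), (7, 7, (-1, 0), (2, 0), (0, 2))],
    [(7, 8, (1, 0), (2, 0), (6, 0)), (7, 9, (1, 0), (1, 1), (1, 3)), (7, 10, (1, 0), (2, 0), (2, 0)), (7, 11, (-1, -1), (-2, 0), (0, 2)), (7, 12, (-1, 0), (2, 0), (6, 0)), (7, 13, (-1, 0), (1, 1), (1, 3)), (7, 14, (-1, 0), (2, 0), (2, 0)), (7, 15, (1, 1), (-2, 0), (0, 2))],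
    [(7, 16, (1, 0), (0, 0), (-2, 2)), (7, 17, (-1, 0), (1, -1), (-1, -1)), (7, 18, (1, 1), (4, 0), (8, 0)), (7, 19, (1, 1), (0, 2), (-2, 4)), (7, 20, (-1, 0), (0, 0), (-2, 2)), (7, 21, (-1, 0), (-1, 1), (1, 1)), (7, 22, (-1, -1), (4, 0), (8, 0)), (7, 23, (-1, -1), (0, 2), (-2, 4))],
    [(7, 24, (1, 0), (0, 0), (2, 0)), (7, 25, (1, 0), (1, 0), (2, 1)), (7, 26, (1, 0), (2, 0), (4, 0)), (7, 27, (1, 0), (0, 1), (-1, 2)), (7, 28, (-1, 0), (0, 0), (2, 0)), (7, 29, (-1, 0), (1, 0), (2, 1)), (7, 30, (-1, 0), (2, 0), (4, 0)), (7, 31, (-1, 0), (0, 1), (-1, 2))],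
    [(7, 32, (-1, -1), (-2, 0), (-6, 0)), (7, 33, (1, 0), (1, 0), (4, -1)), (7, 34, (-1, -1), (-2, 0), (-2, 0)), (7, 35, (-2, -1), (-1, 0), (0, 1)), (7, 36, (-1, -1), (2, 0), (6, 0)), (7, 37, (-1, 0), (1, 0), (4, -1)), (7, 38, (-1, -1), (2, 0), (2, 0)), (7, 39, (-2, -1), (1, 0), (0, -1))],
    [(7, 40, (-1, 1), (0, 1), (1, 2)), (7, 41, (1, -1), (-1, 0), (-2, 1)), (7, 42, (1, -1), (0, 1), (1, 2)), (7, 43, (-1, 1), (-1, 0), (-2, 1)), (7, 44, (1, 1), (1, 0), (4, 1)), (7, 45, (1, 0), (1, 0), (3, 0)), (7, 46, (-1, 1), (1, 0), (4, -1)), (7, 47, (-1, 1), (1, 0), (0, 1))],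
    [(7, 48, (1, 0), (1, 0), (1, 0)), (7, 49, (-1, -1), (-1, 0), (0, 1)), (7, 50, (-1, -1), (1, 0), (4, 1)), (7, 51, (-1, 0), (1, 0), (3, 0)), (7, 52, (1, -1), (1, 0), (4, -1)), (7, 53, (1, -1), (1, 0), (0, 1)), (7, 54, (-1, 0), (1, 0), (1, 0)), (7, 55, (1, 1), (-1, 0), (0, 1))],
    [(7, 56, (-1, 0), (0, 0), (1, -1)), (7, 57, (-2, 0), (1, -1), (-1, -1)), (7, 58, (-1, -1), (-2, 0), (-4, 0)), (7, 59, (-1, -1), (0, -1), (1, -2)), (7, 60, (-1, 0), (0, 0), (-1, 1)), (7, 61, (-2, 0), (-1, 1), (1, 1)), (7, 62, (-1, -1), (2, 0), (4, 0)), (7, 63, (-1, -1), (0, 1), (-1, 2))],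
    [(7, 64, (1, 0), (0, 0), (1, 0)), (7, 65, (-2, 0), (-1, 0), (-2, -1)), (7, 66, (1, 0), (1, 0), (2, 0)), (7, 67, (-2, 0), (0, -1), (1, -2)), (7, 68, (-1, 0), (0, 0), (1, 0)), (7, 69, (-2, 0), (1, 0), (2, 1)), (7, 70, (-1, 0), (1, 0), (2, 0)), (7, 71, (-2, 0), (0, 1), (-1, 2))],
    [(7, 72, (-1, -1), (-1, 0), (-3, 0)), (7, 73, (-2, 0), (-1, 0), (-4, 1)), (7, 74, (-1, -1), (-1, 0), (-1, 0)), (7, 75, (-4, -2), (-1, 0), (0, 1)), (7, 76, (-1, -1), (1, 0), (3, 0)), (7, 77, (-2, 0), (1, 0), (4, -1)), (7, 78, (-1, -1), (1, 0), (1, 0)), (7, 79, (-4, -2), (1, 0), (0, -1))],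
    [(7, 80, (0, 0), (1, 0), (4, 1)), (7, 81, (0, 0), (0, 1), (1, 2)), (7, 82, (0, 0), (1, 0), (0, 1)), (7, 83, (0, 0), (-1, 0), (-2, 1)), (1, 84, (-1, 0), (-1, 1), (-1, 3)), (2, 85, (1, -1), (2, 0), (0, 2)), (3, 86, (-1, 0), (-1, 0), (-2, 1)), (4, 87, (-1, 0), (0, 1), (1, 2))]]"
    by code_simp
  thus ?thesis by (rule interval_if_quad_3_check)
qed

lemma configs_587_596: "{587..596} \<subseteq> sizes"
proof -
  have "check rat_test rat_proper (stages 587 596)
   [[(10, 0, 0, -1, 6), (10, 1, 0, 1, -2), (10, 2, -1, -2, 8), (10, 3, 1, -2, 8), (10, 4, -2, 0, 1), (10, 5, -2, 0, -1), (10, 6, -3, -2, 9), (10, 7, -3, -2, 7)],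
    [(10, 8, -3, 2, -9), (10, 9, -3, 2, -7), (10, 10, -2, -3, 13), (10, 11, -2, -3, 11), (10, 12, 2, -3, 13), (10, 13, 2, -3, 11), (10, 14, -1, -2, 11), (10, 15, 1, 2, -5)],
    [(10, 16, 1, -2, 11), (10, 17, -1, 2, -5), (10, 18, -2, -1, 7), (10, 19, 2, 1, -1), (10, 20, 2, -1, 7), (10, 21, -2, 1, -1), (10, 22, -1, -3, 14), (10, 23, -1, -3, 10)],
    [(10, 24, 1, -3, 14), (10, 25, 1, -3, 10), (10, 26, -3, -1, 6), (10, 27, -3, -1, 2), (10, 28, -3, 1, -6), (10, 29, -3, 1, -2), (10, 30, 1, 1, -2), (10, 31, -1, -1, 6)],
    [(10, 32, -1, 1, -2), (10, 33, 1, -1, 6), (10, 34, -2, 1, -5), (10, 35, -2, 1, -3), (10, 36, -2, -1, 5), (10, 37, -2, -1, 3), (10, 38, 1, -2, 7), (10, 39, 1, -2, 9)],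
    [(10, 40, -1, -2, 7), (10, 41, -1, -2, 9), (10, 42, -2, 2, -5), (10, 43, 2, -2, 11), (10, 44, 2, 2, -5), (10, 45, -3, 2, -10), (10, 46, -3, -2, 6), (10, 47, -3, -2, 10)],
    [(10, 48, 2, -3, 10), (10, 49, -2, -3, 14), (10, 50, -2, -3, 10), (10, 51, -4, 3, -7), (10, 52, 4, -3, 17), (10, 53, 4, 3, -7), (10, 54, -4, -3, 17), (10, 55, 3, -4, 21)],
    [(10, 56, -3, 4, -11), (10, 57, -3, -4, 21), (10, 58, 3, 4, -11), (10, 59, -5, 3, -8), (10, 60, -5, 3, -16), (10, 61, -5, -3, 8), (10, 62, -5, -3, 16), (10, 63, 3, -5, 24)],
    [(10, 64, 3, -5, 16), (10, 65, -3, -5, 24), (10, 66, -3, -5, 16), (10, 67, -5, -4, 13), (10, 68, -5, -4, 19), (10, 69, -5, 4, -13), (10, 70, -5, 4, -19), (10, 71, -4, -5, 17)],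
    [(10, 72, -4, -5, 23), (10, 73, 4, -5, 17), (10, 74, 4, -5, 23), (8, 75, 2, 3, -9), (10, 76, -2, -3, 15), (10, 77, -2, 3, -9), (10, 78, 2, -3, 15), (3, 79, 3, 2, -5)],
    [(10, 80, -3, -2, 11), (10, 81, -3, 2, -5), (10, 82, 3, -2, 11), (10, 83, -3, 3, -14), (10, 84, -3, 3, -10), (10, 85, -3, -3, 14), (10, 86, -3, -3, 10), (10, 87, 1, 1, -3)]]
   [[(7, 0, 1, 1, 4), (10, 1, -1, 1, 4), (10, 2, 0, 1, 3), (10, 3, 0, 1, 5), (10, 4, 1, 0, -1), (10, 5, 1, 0, 1), (10, 6, -1, -1, -6), (10, 7, -1, 1, 2)],
    [(10, 8, 1, -1, -6), (10, 9, 1, 1, 2), (10, 10, 2, -1, -3), (10, 11, 2, 1, 5), (10, 12, 2, 1, 3), (10, 13, 2, -1, -5), (10, 14, -1, 2, 9), (10, 15, 1, 2, 7)],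
    [(10, 16, 1, 2, 9), (10, 17, -1, 2, 7), (2, 18, -1, 2, 8), (10, 19, 2, 0, 1), (10, 20, 2, 0, -1), (5, 21, 0, -1, -6), (10, 22, 0, 1, 2), (10, 23, -2, 0, -3)],
    [(10, 24, 2, 0, -3), (10, 25, 3, 0, 2), (10, 26, 3, 0, -2), (10, 27, 0, -2, -11), (10, 28, 0, 2, 5), (10, 29, 3, -2, -8), (10, 30, 3, 2, 8), (10, 31, 0, 3, 14)],
    [(10, 32, 0, 3, 10), (10, 33, -2, 3, 12), (10, 34, 2, 3, 12), (10, 35, 3, -1, -3), (6, 36, 3, -1, -5), (10, 37, 3, 1, 3), (1, 38, -1, 1, 1), (10, 39, -1, -1, -7)],
    [(10, 40, 1, 1, 1), (10, 41, 1, -1, -7), (10, 42, 1, 3, 13), (10, 43, -1, 3, 11), (10, 44, -1, 3, 13), (10, 45, 1, 3, 11), (10, 46, -5, 1, -3), (10, 47, -5, -1, -11)],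
    [(10, 48, 5, 1, -3), (10, 49, 5, -1, -11), (10, 50, 7, 1, 9), (10, 51, 7, -1, 1), (10, 52, 7, -1, -9), (10, 53, 7, 1, -1), (10, 54, 1, -5, -27), (10, 55, 1, 5, 13)],
    [(10, 56, -1, -5, -27), (10, 57, -1, 5, 13), (10, 58, 7, -5, -21), (10, 59, 7, 5, 19), (10, 60, 7, 5, 21), (10, 61, 7, -5, -19), (10, 62, 1, 7, 33), (10, 63, -1, 7, 23)],
    [(10, 64, -1, 7, 33), (10, 65, 1, 7, 23), (10, 66, -5, 7, 27), (10, 67, 5, 7, 29), (10, 68, 5, 7, 27), (10, 69, -5, 7, 29), (10, 70, -2, 2, 7), (4, 71, 2, 2, 9)],
    [(10, 72, 2, 2, 7), (10, 73, 1, 2, 10), (10, 74, -1, 2, 6), (10, 75, 1, 2, 6), (10, 76, 2, 1, 6), (10, 77, 2, -1, -2), (10, 78, 2, 1, 2), (10, 79, -3, 3, 11)],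
    [(10, 80, 3, 3, 13), (10, 81, 3, 3, 11), (10, 82, -3, 3, 13), (10, 83, 1, 3, 15), (10, 84, -1, 3, 9), (10, 85, -1, 3, 15), (10, 86, 1, 3, 9), (10, 87, 3, 1, 7)],
    [(9, 88, 3, -1, -1), (10, 89, 3, -1, -7), (10, 90, 3, 1, 1), (10, 91, 4, 1, 6), (10, 92, 1, -2, -12), (10, 93, -1, 2, 4), (10, 94, 2, 4, 15)]]"
    by code_simp
  thus ?thesis by (rule interval_if_rat_check)
qed

text \<open>Up to homogeneous factors and numbering, the points are those of
  \<open>configs_608_616\<close> without its points 2, 3, 4, 5, 10 and 11.\<close>

lemma configs_597_607: "{597..607} \<subseteq> sizes"
proof -
  have "check rat_test rat_proper (stages 597 607)
   [[(11, 0, 0, -1, 6), (11, 1, 0, 1, -2), (11, 2, -1, -2, 8), (11, 3, 1, -2, 8), (11, 4, -2, 0, 1), (11, 5, -2, 0, -1), (11, 6, -3, -2, 9), (11, 7, -3, -2, 7)],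
    [(11, 8, -3, 2, -9), (11, 9, -3, 2, -7), (11, 10, -2, -3, 13), (11, 11, -2, -3, 11), (11, 12, 2, -3, 13), (11, 13, 2, -3, 11), (11, 14, -1, -2, 11), (11, 15, 1, 2, -5)],
    [(11, 16, 1, -2, 11), (11, 17, -1, 2, -5), (11, 18, -2, -1, 7), (11, 19, 2, 1, -1), (11, 20, 2, -1, 7), (11, 21, -2, 1, -1), (11, 22, -1, -3, 14), (11, 23, -1, -3, 10)],
    [(11, 24, 1, -3, 14), (11, 25, 1, -3, 10), (11, 26, -3, -1, 6), (11, 27, -3, -1, 2), (11, 28, -3, 1, -6), (11, 29, -3, 1, -2), (11, 30, 1, 1, -2), (11, 31, -1, -1, 6)],
    [(11, 32, -1, 1, -2), (11, 33, 1, -1, 6), (11, 34, -2, 1, -5), (11, 35, -2, 1, -3), (11, 36, -2, -1, 5), (11, 37, -2, -1, 3), (11, 38, 1, -2, 7), (11, 39, 1, -2, 9)],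
    [(11, 40, -1, -2, 7), (11, 41, -1, -2, 9), (11, 42, -2, 2, -5), (11, 43, 2, -2, 11), (11, 44, 2, 2, -5), (11, 45, -2, -2, 11), (11, 46, -3, 2, -6), (11, 47, -3, 2, -10)],
    [(11, 48, -3, -2, 6), (11, 49, -3, -2, 10), (11, 50, 2, -3, 14), (11, 51, 2, -3, 10), (11, 52, -2, -3, 14), (11, 53, -2, -3, 10), (11, 54, -4, 3, -7), (11, 55, 4, -3, 17)],
    [(11, 56, 4, 3, -7), (11, 57, -4, -3, 17), (11, 58, 3, -4, 21), (11, 59, -3, 4, -11), (11, 60, -3, -4, 21), (11, 61, 3, 4, -11), (11, 62, -5, 3, -8), (11, 63, -5, 3, -16)],
    [(11, 64, -5, -3, 8), (11, 65, -5, -3, 16), (11, 66, 3, -5, 24), (11, 67, 3, -5, 16), (11, 68, -3, -5, 24), (11, 69, -3, -5, 16), (11, 70, -5, -4, 13), (11, 71, -5, -4, 19)],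
    [(11, 72, -5, 4, -13), (11, 73, -5, 4, -19), (11, 74, -4, -5, 17), (11, 75, -4, -5, 23), (11, 76, 4, -5, 17), (11, 77, 4, -5, 23), (11, 78, 2, 3, -9), (11, 79, -2, -3, 15)],
    [(10, 80, -2, 3, -9), (11, 81, 2, -3, 15), (8, 82, 3, 2, -5), (11, 83, -3, -2, 11), (11, 84, -3, 2, -5), (11, 85, 3, -2, 11), (11, 86, -3, 3, -14), (11, 87, -3, 3, -10)],
    [(11, 88, -3, -3, 14), (7, 89, -3, -3, 10)]]
   [[(11, 0, 1, 1, 4), (11, 1, -1, 1, 4), (11, 2, 0, 1, 3), (11, 3, 0, 1, 5), (11, 4, 1, 0, -1), (11, 5, 1, 0, 1), (11, 6, -1, -1, -6), (11, 7, -1, 1, 2)],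
    [(11, 8, 1, -1, -6), (11, 9, 1, 1, 2), (11, 10, 2, -1, -3), (11, 11, 2, 1, 5), (11, 12, 2, 1, 3), (11, 13, 2, -1, -5), (11, 14, -1, 2, 9), (11, 15, 1, 2, 7)],
    [(11, 16, 1, 2, 9), (11, 17, -1, 2, 7), (11, 18, -1, 2, 8), (11, 19, 1, 2, 8), (11, 20, 2, 0, 1), (11, 21, 2, 0, -1), (11, 22, 0, -1, -6), (11, 23, 0, 1, 2)],
    [(11, 24, -2, 0, -3), (11, 25, 2, 0, -3), (11, 26, 3, 0, 2), (11, 27, 3, 0, -2), (11, 28, 0, -2, -11), (11, 29, 0, 2, 5), (11, 30, 3, -2, -8), (11, 31, 3, 2, 8)],
    [(11, 32, 0, 3, 14), (11, 33, 0, 3, 10), (11, 34, -2, 3, 12), (11, 35, 2, 3, 12), (11, 36, 3, 1, 5), (11, 37, 3, -1, -3), (6, 38, 3, -1, -5), (11, 39, 3, 1, 3)],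
    [(2, 40, -1, 1, 1), (11, 41, -1, -1, -7), (11, 42, 1, 1, 1), (11, 43, 1, -1, -7), (11, 44, 1, 3, 13), (11, 45, -1, 3, 11), (11, 46, -1, 3, 13), (11, 47, -5, 1, -3)],
    [(11, 48, -5, -1, -11), (11, 49, 5, 1, -3), (11, 50, 5, -1, -11), (11, 51, 7, 1, 9), (5, 52, 7, -1, 1), (11, 53, 7, -1, -9), (11, 54, 7, 1, -1), (3, 55, 1, -5, -27)],
    [(11, 56, 1, 5, 13), (1, 57, -1, -5, -27), (11, 58, -1, 5, 13), (11, 59, 7, -5, -21), (11, 60, 7, 5, 19), (11, 61, 7, 5, 21), (11, 62, 7, -5, -19), (11, 63, 1, 7, 33)],
    [(11, 64, -1, 7, 23), (11, 65, -1, 7, 33), (11, 66, 1, 7, 23), (11, 67, -5, 7, 27), (11, 68, 5, 7, 29), (11, 69, 5, 7, 27), (9, 70, -5, 7, 29), (11, 71, -2, 2, 7)],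
    [(11, 72, 2, 2, 9), (11, 73, 2, 2, 7), (11, 74, -2, 2, 9), (11, 75, 1, 2, 10), (11, 76, -1, 2, 6), (11, 77, -1, 2, 10), (11, 78, 1, 2, 6), (11, 79, 2, 1, 6)],
    [(11, 80, 2, -1, -2), (11, 81, 2, -1, -6), (11, 82, 2, 1, 2), (11, 83, -3, 3, 11), (11, 84, 3, 3, 13), (11, 85, 3, 3, 11), (11, 86, -3, 3, 13), (11, 87, 1, 3, 15)],
    [(11, 88, -1, 3, 9), (11, 89, -1, 3, 15), (11, 90, 1, 3, 9), (11, 91, 3, 1, 7), (11, 92, 3, -1, -1), (11, 93, 3, -1, -7), (11, 94, 3, 1, 1), (11, 95, -1, 2, 4)],
    [(4, 96, 2, 4, 15)]]"
    by code_simp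
  thus ?thesis by (rule interval_if_rat_check)
qed

text \<open>In the homogeneous coordinates \<open>(u, v, w + 4 v)\<close> the 96 points are
  invariant under the symmetries of a square: sign changes and the exchange of the first two
  coordinates. Points 2, 3, 8 and 9 become the points at infinity in the directions
  \<open>(2, 1)\<close>, \<open>(2, -1)\<close>, \<open>(1, 2)\<close> and
  \<open>(1, -2)\<close>.\<close>

lemma configs_608_616: "{608..616} \<subseteq> sizes"
proof -
  have "check rat_test rat_proper (stages 608 616)
   [[(9, 0, -2, 0, -1), (9, 1, -2, 0, 1), (9, 2, -2, -1, 4), (9, 3, -2, 1, -4), (9, 4, 0, -2, 7), (9, 5, 0, -2, 9), (9, 6, 0, -1, 2), (9, 7, 0, 1, -6)],
    [(9, 8, -1, -2, 8), (9, 9, 1, -2, 8), (9, 10, -1, 0, -2), (9, 11, 1, 0, -2), (9, 12, -1, -3, 10), (9, 13, 1, -3, 10), (9, 14, 1, -3, 14), (9, 15, -1, -3, 14)],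
    [(9, 16, -1, -2, 5), (9, 17, 1, -2, 5), (9, 18, -1, 2, -11), (9, 19, 1, 2, -11), (9, 20, -3, -1, 2), (9, 21, -3, 1, -2), (9, 22, -3, 1, -6), (9, 23, -3, -1, 6)],
    [(9, 24, -3, -2, 7), (9, 25, -3, 2, -7), (9, 26, -3, 2, -9), (9, 27, -3, -2, 9), (9, 28, -2, -1, 1), (9, 29, 2, -1, 1), (9, 30, -2, 1, -7), (9, 31, 2, 1, -7)],
    [(9, 32, -2, -3, 11), (9, 33, 2, -3, 11), (9, 34, 2, -3, 13), (9, 35, -2, -3, 13), (9, 36, -2, 1, -3), (9, 37, -2, -1, 3), (9, 38, -2, -1, 5), (9, 39, -2, 1, -5)],
    [(9, 40, 1, -2, 9), (9, 41, -1, -2, 9), (9, 42, -1, -2, 7), (9, 43, 1, -2, 7), (9, 44, 1, 1, -6), (9, 45, -1, 1, -6), (9, 46, 1, -1, 2), (9, 47, -1, -1, 2)],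
    [(9, 48, -3, -2, 10), (1, 49, -3, 2, -10), (9, 50, -3, 2, -6), (9, 51, -3, -2, 6), (9, 52, -2, -3, 14), (2, 53, 2, -3, 14), (9, 54, 2, -3, 10), (9, 55, -2, -3, 10)],
    [(9, 56, -2, 2, -11), (9, 57, 2, 2, -11), (9, 58, -2, -2, 5), (9, 59, 2, -2, 5), (9, 60, -5, -4, 19), (9, 61, -5, 4, -19), (9, 62, -5, 4, -13), (9, 63, -5, -4, 13)],
    [(9, 64, -5, 3, -16), (9, 65, -5, -3, 16), (9, 66, -5, -3, 8), (9, 67, -5, 3, -8), (9, 68, -4, -5, 23), (9, 69, 4, -5, 23), (9, 70, 4, -5, 17), (9, 71, -4, -5, 17)],
    [(9, 72, -4, 3, -17), (9, 73, 4, 3, -17), (9, 74, -4, -3, 7), (9, 75, 4, -3, 7), (9, 76, 3, -5, 16), (9, 77, -3, -5, 16), (9, 78, -3, -5, 24), (9, 79, 3, -5, 24)],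
    [(9, 80, 3, -4, 11), (9, 81, -3, -4, 11), (9, 82, 3, 4, -21), (9, 83, -3, 4, -21), (9, 84, -3, 2, -5), (9, 85, -3, -2, 5), (4, 86, -3, -2, 11), (9, 87, -3, 2, -11)],
    [(3, 88, -3, 3, -10), (9, 89, -3, -3, 10), (9, 90, -3, -3, 14), (9, 91, -3, 3, -14), (9, 92, 2, -3, 15), (9, 93, -2, -3, 15), (9, 94, -2, -3, 9), (9, 95, 2, -3, 9)]]
   [[(9, 0, -1, 0, 1), (9, 1, -1, 0, -1), (9, 2, -1, 1, 4), (9, 3, -1, -1, -4), (9, 4, 0, 1, 5), (9, 5, 0, -1, -3), (9, 6, 1, 2, 7), (9, 7, -1, 2, 7)],
    [(9, 8, 1, 2, 9), (9, 9, -1, 2, 9), (9, 10, 1, -1, -2), (9, 11, -1, -1, -2), (9, 12, -1, 1, 6), (9, 13, 1, 1, 6), (9, 14, -2, -1, -5), (9, 15, -2, 1, 5)],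
    [(9, 16, -2, -1, -3), (9, 17, -2, 1, 3), (9, 18, -2, -1, -4), (9, 19, -2, 1, 4), (9, 20, -2, 0, -1), (9, 21, -2, 0, 1), (9, 22, 0, -1, -2), (9, 23, 0, 1, 6)],
    [(9, 24, 0, 2, 7), (9, 25, 0, 2, 9), (9, 26, 1, 0, 2), (9, 27, -1, 0, 2), (9, 28, 1, 2, 8), (9, 29, -1, 2, 8), (9, 30, 0, 3, 10), (9, 31, 0, 3, 14)],
    [(9, 32, 0, -2, -5), (9, 33, 0, 2, 11), (9, 34, 2, 3, 12), (9, 35, -2, 3, 12), (9, 36, 2, 0, 3), (9, 37, -2, 0, 3), (9, 38, -3, -2, -8), (9, 39, -3, 2, 8)],
    [(9, 40, -3, 0, -2), (9, 41, -3, 0, 2), (9, 42, -1, 7, 23), (9, 43, 1, 7, 23), (9, 44, -1, 7, 33), (9, 45, 1, 7, 33), (9, 46, -1, -5, -13), (9, 47, 1, -5, -13)],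
    [(9, 48, 1, 5, 27), (9, 49, -1, 5, 27), (9, 50, 5, 7, 29), (9, 51, -5, 7, 29), (9, 52, 5, 7, 27), (9, 53, -5, 7, 27), (9, 54, 5, 1, 11), (9, 55, -5, 1, 11)],
    [(9, 56, -5, -1, 3), (9, 57, 5, -1, 3), (9, 58, -7, -5, -19), (9, 59, -7, 5, 19), (9, 60, -7, -5, -21), (9, 61, -7, 5, 21), (9, 62, -7, 1, -1), (9, 63, -7, -1, 1)],
    [(9, 64, -7, 1, 9), (9, 65, -7, -1, -9), (9, 66, -2, 1, 2), (9, 67, -2, -1, -2), (9, 68, -2, 1, 6), (9, 69, -2, -1, -6), (9, 70, -2, -2, -7), (9, 71, -2, 2, 7)],
    [(9, 72, -2, -2, -9), (9, 73, -2, 2, 9), (9, 74, -1, -2, -6), (9, 75, 1, -2, -6), (9, 76, 1, 2, 10), (9, 77, -1, 2, 10), (9, 78, -3, 1, 1), (9, 79, -3, -1, -1)],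
    [(9, 80, -3, 1, 7), (9, 81, -3, -1, -7), (9, 82, -3, -3, -11), (9, 83, -3, 3, 11), (9, 84, -3, -3, -13), (9, 85, -3, 3, 13), (9, 86, -1, -3, -9), (9, 87, 1, -3, -9)],
    [(9, 88, 1, 3, 15), (9, 89, -1, 3, 15), (5, 90, 1, 3, 13), (8, 91, -3, 1, 3), (6, 92, -1, -1, -1), (7, 93, -3, -1, -5)]]"
    by code_simp
  thus ?thesis by (rule interval_if_rat_check)
qed

lemma configs_614_622: "{614..622} \<subseteq> sizes"
proof -
  have "check rat_test rat_proper (stages 614 622)
   [[(9, 0, -1, 0, 1), (9, 1, 0, 0, -1), (9, 2, -2, -1, -3), (9, 3, 0, 1, 3), (9, 4, -2, -1, -1), (9, 5, 0, 1, 5), (9, 6, -3, -1, 7), (9, 7, -9, -1, 7)],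
    [(9, 8, -7, 1, 13), (9, 9, -1, 1, 13), (9, 10, -3, -5, -13), (9, 11, -9, -5, -13), (9, 12, -1, -5, -17), (9, 13, -7, -5, -17), (9, 14, -3, -1, -9), (9, 15, -7, 1, 9)],
    [(9, 16, -9, -1, 3), (9, 17, -1, 1, -3), (9, 18, -3, 3, 11), (9, 19, -7, -3, -11), (9, 20, -1, 3, 7), (9, 21, -9, -3, -7), (9, 22, -3, -5, -21), (9, 23, -1, -5, -21)],
    [(9, 24, -9, -5, -9), (9, 25, -7, -5, -9), (9, 26, -3, 3, 19), (9, 27, -1, 3, 19), (9, 28, -7, -3, 1), (9, 29, -9, -3, 1), (9, 30, 0, 1, 1), (9, 31, -4, -1, -1)],
    [(9, 32, -2, 1, 5), (9, 33, -2, -1, -5), (9, 34, 0, 1, 7), (9, 35, -2, 1, 7), (9, 36, -4, -1, 1), (9, 37, -2, -1, 1), (9, 38, 0, -1, -4), (9, 39, -1, -1, -4)],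
    [(9, 40, -1, -1, -2), (9, 41, -2, -1, -2), (9, 42, -1, -1, -7), (9, 43, -3, 1, 7), (9, 44, -5, -1, 1), (9, 45, 1, 1, -1), (9, 46, -1, 2, 8), (9, 47, -3, -2, -8)],
    [(9, 48, 1, 2, 4), (9, 49, -5, -2, -4), (9, 50, -1, 2, 10), (9, 51, 1, 2, 10), (9, 52, -3, -2, -2), (9, 53, -5, -2, -2), (9, 54, -5, -1, 5), (9, 55, -3, 1, 11)],
    [(9, 56, -5, -4, -10), (9, 57, -3, -4, -14), (9, 58, -5, -1, -3), (9, 59, -3, 1, 3), (9, 60, -5, 0, 2), (9, 61, -3, 0, -2), (9, 62, -5, -4, -12), (9, 63, -3, -4, -12)],
    [(9, 64, -5, 0, 8), (9, 65, -3, 0, 8), (9, 66, -9, 4, 28), (9, 67, 1, 4, 28), (9, 68, -7, -4, 4), (9, 69, -17, -4, 4), (9, 70, -9, -8, -32), (9, 71, 1, -8, -32)],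
    [(9, 72, -17, -8, -16), (9, 73, -7, -8, -16), (9, 74, -9, 4, 22), (9, 75, -7, -4, -22), (9, 76, 1, 4, 2), (9, 77, -17, -4, -2), (9, 78, -9, -5, -23), (9, 79, -7, 5, 23)],
    [(9, 80, -17, -5, -7), (9, 81, 1, 5, 7), (9, 82, -9, -8, -14), (9, 83, -17, -8, -14), (9, 84, 1, -8, -34), (9, 85, -7, -8, -34), (9, 86, -9, -5, 1), (9, 87, -17, -5, 1)],
    [(9, 88, -7, 5, 31), (9, 89, 1, 5, 31), (3, 90, -3, -1, 3), (1, 91, -5, -1, -1), (4, 92, -1, 1, 9), (7, 93, -3, -3, -7)]]
   [[(9, 0, -2, 1, -5), (9, 1, 0, -1, 3), (9, 2, 0, 0, 1), (9, 3, -1, 0, -1), (9, 4, -1, 1, -4), (9, 5, -2, 1, -3), (9, 6, -2, 1, -7), (9, 7, 0, -1, 5)],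
    [(9, 8, 0, -1, 1), (6, 9, 1, 0, 3), (2, 10, -1, 1, -2), (9, 11, 1, -1, 6), (9, 12, -1, 0, 1), (8, 13, 2, -3, 9), (5, 14, -2, -1, -1), (9, 15, -2, -1, 3)],
    [(9, 16, 2, -3, 13), (9, 17, -4, 3, -15), (9, 18, -4, 1, -5), (9, 19, -4, 1, -9), (9, 20, -4, 3, -11), (9, 21, -2, 1, -6), (9, 22, -2, 1, -4), (9, 23, -4, 3, -13)],
    [(9, 24, -4, 1, -7), (9, 25, 0, -1, 2), (9, 26, 0, -1, 4), (9, 27, 0, 1, 1), (9, 28, 0, -1, 7), (9, 29, 2, -3, 11), (9, 30, -2, -1, 1), (9, 31, 2, -1, 9)],
    [(9, 32, -2, 1, -1), (9, 33, -8, 3, -3), (9, 34, 8, -5, 37), (9, 35, -8, 5, -9), (9, 36, 8, -3, 31), (9, 37, -8, -3, 3), (9, 38, 8, -11, 43), (9, 39, 8, -11, 39)],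
    [(9, 40, -8, -3, -1), (9, 41, -2, -3, 21), (9, 42, 2, -5, 31), (9, 43, -2, 5, -3), (9, 44, 2, 3, 7), (9, 45, -1, -3, 12), (9, 46, 1, -4, 17), (9, 47, 1, -4, 9)],
    [(9, 48, -1, -3, 4), (9, 49, -14, 3, -21), (9, 50, -14, 11, -49), (9, 51, -14, 11, -45), (9, 52, -14, 3, -25), (9, 53, -7, 3, -12), (9, 54, -7, 4, -23), (9, 55, -7, 4, -15)],
    [(9, 56, -7, 3, -20), (9, 57, 3, -1, 10), (9, 58, -3, 2, -5), (9, 59, 3, -2, 13), (9, 60, -3, 1, -2), (9, 61, 6, -7, 25), (9, 62, -6, -1, -5), (9, 63, -6, -1, -1)],
    [(9, 64, 6, -7, 29), (9, 65, 1, 1, 2), (9, 66, -1, 2, -3), (9, 67, 1, -2, 11), (9, 68, -1, -1, 6), (9, 69, 2, -5, 11), (9, 70, -2, -3, 1), (9, 71, -2, -3, 13)],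
    [(9, 72, 2, -5, 23), (9, 73, -8, 7, -31), (9, 74, -8, 1, -9), (9, 75, -8, 1, -13), (9, 76, -8, 7, -27), (9, 77, -8, 5, -29), (9, 78, -8, 3, -11), (9, 79, -8, 3, -23)],
    [(9, 80, -8, 5, -17), (9, 81, -10, 1, -23), (9, 82, -10, 9, -27), (9, 83, -10, 9, -47), (9, 84, -10, 1, -3), (9, 85, -5, 5, -16), (9, 86, -5, 0, -9), (9, 87, -5, 0, -1)],
    [(9, 88, -5, 5, -24), (9, 89, -8, -1, -15), (9, 90, 8, -9, 25), (9, 91, 8, -9, 45), (9, 92, -8, -1, 5)]]"
    by code_simp
  thus ?thesis by (rule interval_if_rat_check)
qed

section \<open>From finitely many intervals to all sizes\<close>

lemma sizes_580_866: "{580..866} \<subseteq> sizes"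
proof -
  have "{580..586} \<subseteq> sizes" by (rule configs_580_586)
  from interval_join[OF this configs_587_596] have "{580..596} \<subseteq> sizes" by simp
  from interval_join[OF this configs_597_607] have "{580..607} \<subseteq> sizes" by simp
  from interval_join[OF this configs_608_616] have "{580..616} \<subseteq> sizes" by simp
  from interval_join[OF this configs_614_622] have "{580..622} \<subseteq> sizes" by simp
  \<comment> \<open>Single systems reach 622. Unions of two take over here, since
    \<open>282 + 340 = 622\<close>; below, each pair starts at most one above the end reached so
    far, up to \<open>433 + 433 = 866\<close>.\<close>
  from interval_extend[OF this config_282 configs_340_344] have "{580..626} \<subseteq> sizes" by simp
  from interval_extend[OF this config_288 config_339] have "{580..627} \<subseteq> sizes" by simp
  from interval_extend[OF this config_288 configs_340_344] have "{580..632} \<subseteq> sizes" by simp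
  from interval_extend[OF this config_282 configs_350_360] have "{580..642} \<subseteq> sizes" by simp
  from interval_extend[OF this config_288 configs_350_360] have "{580..648} \<subseteq> sizes" by simp
  from interval_extend[OF this config_296 configs_350_360] have "{580..656} \<subseteq> sizes" by simp
  from interval_extend[OF this config_282 configs_374_378] have "{580..660} \<subseteq> sizes" by simp
  from interval_extend[OF this config_282 configs_378_386] have "{580..668} \<subseteq> sizes" by simp
  from interval_extend[OF this config_288 configs_378_386] have "{580..674} \<subseteq> sizes" by simp
  from interval_extend[OF this config_296 configs_378_386] have "{580..682} \<subseteq> sizes" by simp
  from interval_extend[OF this configs_340_344 configs_340_344] have "{580..688} \<subseteq> sizes" by simp
  from interval_extend[OF this config_339 configs_350_360] have "{580..699} \<subseteq> sizes" by simp
  from interval_extend[OF this configs_350_360 configs_350_360] have "{580..720} \<subseteq> sizes" by simp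
  from interval_extend[OF this configs_340_344 configs_378_386] have "{580..730} \<subseteq> sizes" by simp
  from interval_extend[OF this configs_350_360 configs_378_386] have "{580..746} \<subseteq> sizes" by simp
  from interval_extend[OF this configs_350_360 configs_390_392] have "{580..752} \<subseteq> sizes" by simp
  from interval_extend[OF this configs_374_378 configs_378_386] have "{580..764} \<subseteq> sizes" by simp
  from interval_extend[OF this configs_340_344 configs_424_433] have "{580..777} \<subseteq> sizes" by simp
  from interval_extend[OF this configs_350_360 configs_424_433] have "{580..793} \<subseteq> sizes" by simp
  from interval_extend[OF this configs_340_344 configs_452_456] have "{580..800} \<subseteq> sizes" by simp
  from interval_extend[OF this configs_374_378 configs_424_433] have "{580..811} \<subseteq> sizes" by simp
  from interval_extend[OF this configs_378_386 configs_424_433] have "{580..819} \<subseteq> sizes" by simp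
  from interval_extend[OF this configs_390_392 configs_424_433] have "{580..825} \<subseteq> sizes" by simp
  from interval_extend[OF this configs_374_378 configs_452_456] have "{580..834} \<subseteq> sizes" by simp
  from interval_extend[OF this configs_378_386 configs_452_456] have "{580..842} \<subseteq> sizes" by simp
  from interval_extend[OF this configs_390_392 configs_452_456] have "{580..848} \<subseteq> sizes" by simp
  from interval_extend[OF this configs_424_433 configs_424_433] have "{580..866} \<subseteq> sizes" by simp
  thus ?thesis .
qed

lemma sizes_ge_585:
  "n \<ge> 585 \<Longrightarrow> n \<in> sizes"
proof (induction n rule: less_induct)
  case (less n)
  show ?case
  proof (cases "n \<le> 866")
    case True
    thus ?thesis using less.prems sizes_580_866 by auto
  next
    case False
    \<comment> \<open>The range up to 866 is just long enough to step down by the smallest system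
      and stay above the threshold: \<open>867 - 282 = 585\<close>.\<close>
    hence "{n - 282..n - 282} \<subseteq> sizes" using less.IH[of "n - 282"] by simp
    from interval_plus_interval[OF this config_282] False show ?thesis by simp
  qed
qed

theorem mainTheorem2:
  "(\<forall>n\<ge>585. has_geometric_configuration n 6) \<and> N_conf 6 \<le> 585"
proof -
  have "\<forall>n\<ge>585. has_geometric_configuration n 6"
    using sizes_ge_585 slope_configuration_imp_geometric unfolding sizes_def by blast
  \<comment> \<open>The value 585 satisfies the predicate under \<open>LEAST\<close>, which gives
    both the bound and the existence that makes \<open>N_conf 6\<close> meaningful.\<close>
  thus ?thesis unfolding N_conf_def by (blast intro: Least_le)
qed

end
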